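(* Let $\mathcal{C}_{2br}$ denote the free symmetric category generated by a single braided object $(V,\sigma_V)$, and let $c$ be its symmetric braiding. Then for each $n$ there is a group isomorphism $$\psi_{virt}: VB_n \stackrel{\sim}{\longrightarrow} \operatorname{End}_{\mathcal{C}_{2br}}(V^{\otimes n}),$$ given on generators by $$\zeta_i \longmapsto \operatorname{Id}_V^{\otimes (i-1)}\otimes c_{V,V} \otimes \operatorname{Id}_V^{\otimes (n-i-1)},\qquad \sigma_i^{\pm 1} \longmapsto \operatorname{Id}_V^{\otimes (i-1)}\otimes \sigma_{V}^{\pm 1} \otimes \operatorname{Id}_V^{\otimes (n-i-1)}.$$
   Context: All monoidal categories are strict. A braided category is a strict monoidal category with a natural family of isomorphisms $c_{V,W}:V\otimes W\to W\otimes V$ satisfying $c_{V,W\otimes U}=(\operatorname{Id}_W\otimes c_{V,U})\circ(c_{V,W}\otimes \operatorname{Id}_U)$ and $c_{V\otimes W,U}=(c_{V,U}\otimes \operatorname{Id}_W)\circ(\operatorname{Id}_V\otimes c_{W,U})$. It is a symmetric category if moreover $c_{V,W}\circ c_{W,V}=\operatorname{Id}_{W\otimes V}$ for all objects $V,W$. A braided object in a monoidal category is an object $V$ endowed with a specific braiding, i.e. an invertible morphism $\sigma_V:V\otimes V\to V\otimes V$ satisfying the Yang-Baxter equation $$(\sigma_V\otimes \operatorname{Id}_V)(\operatorname{Id}_V\otimes\sigma_V)(\sigma_V\otimes \operatorname{Id}_V)=(\operatorname{Id}_V\otimes\sigma_V)(\sigma_V\otimes \operatorname{Id}_V)(\operatorname{Id}_V\otimes\sigma_V).$$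 The free symmetric category generated by a single braided object is the universal symmetric category containing a braided object $(V,\sigma_V)$: for every symmetric category $\mathcal{D}$ and braided object $(W,\sigma_W)$ in $\mathcal{D}$ there is a unique strict monoidal functor to $\mathcal{D}$ preserving the symmetric braidings and sending $(V,\sigma_V)$ to $(W,\sigma_W)$. The virtual braid group $VB_n$ is the group with generators $\sigma_i,\zeta_i$ $(1\le i\le n-1)$ and relations: (1) $\sigma_i\sigma_j=\sigma_j\sigma_i$ for $|i-j|>1$ and $\sigma_i\sigma_{i+1}\sigma_i=\sigma_{i+1}\sigma_i\sigma_{i+1}$; (2) $\zeta_i\zeta_j=\zeta_j\zeta_i$ for $|i-j|>1$, $\zeta_i\zeta_{i+1}\zeta_i=\zeta_{i+1}\zeta_i\zeta_{i+1}$, and $\zeta_i^2=1$; (3) $\sigma_i\zeta_j=\zeta_j\sigma_i$ for $|i-j|>1$, and $\zeta_i\zeta_{i+1}\sigma_i=\sigma_{i+1}\zeta_i\zeta_{i+1}$ for $1\le i\le n-2$. *)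

theory Defs
  imports "HOL-Algebra.Group"
begin

section \<open>Strict monoidal, braided and symmetric categories\<close>

text \<open>Composition \<open>g \<cdot> f\<close> is written in applicative order: first \<open>f\<close>, then \<open>g\<close>.
  All operations are total functions, constrained only on \<open>Obj\<close> and on (composable
  elements of) \<open>Arr\<close>.\<close>

record ('o, 'm) strict_monoidal =
  Obj :: "'o set"
  Arr :: "'m set"
  Dom :: "'m \<Rightarrow> 'o"
  Cod :: "'m \<Rightarrow> 'o"
  Ident :: "'o \<Rightarrow> 'm"
  Comp :: "'m \<Rightarrow> 'm \<Rightarrow> 'm"  (infixl \<open>\<cdot>\<index>\<close> 65)
  Unit :: "'o"
  TensorO :: "'o \<Rightarrow> 'o \<Rightarrow> 'o"  (infixl \<open>\<odot>\<index>\<close> 70)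
  TensorA :: "'m \<Rightarrow> 'm \<Rightarrow> 'm"  (infixl \<open>\<boxtimes>\<index>\<close> 70)

record ('o, 'm) braided_monoidal = "('o, 'm) strict_monoidal" +
  Braid :: "'o \<Rightarrow> 'o \<Rightarrow> 'm"

definition Hom :: "('o, 'm, 'x) strict_monoidal_scheme \<Rightarrow> 'o \<Rightarrow> 'o \<Rightarrow> 'm set"
  where "Hom C A B = {f \<in> Arr C. Dom C f = A \<and> Cod C f = B}"

locale category =
  fixes C :: "('o, 'm, 'x) strict_monoidal_scheme" (structure)
  assumes Dom_closed: "f \<in> Arr C \<Longrightarrow> Dom C f \<in> Obj C"
    and Cod_closed: "f \<in> Arr C \<Longrightarrow> Cod C f \<in> Obj C"
    and Ident_closed: "A \<in> Obj C \<Longrightarrow> Ident C A \<in> Hom C A A"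
    and Comp_closed: "\<lbrakk>f \<in> Hom C A B; g \<in> Hom C B D\<rbrakk> \<Longrightarrow> g \<cdot> f \<in> Hom C A D"
    and Comp_Ident_right: "f \<in> Hom C A B \<Longrightarrow> f \<cdot> Ident C A = f"
    and Comp_Ident_left: "f \<in> Hom C A B \<Longrightarrow> Ident C B \<cdot> f = f"
    and Comp_assoc: "\<lbrakk>f \<in> Hom C A B; g \<in> Hom C B D; h \<in> Hom C D E\<rbrakk>
          \<Longrightarrow> (h \<cdot> g) \<cdot> f = h \<cdot> (g \<cdot> f)"

locale strict_monoidal_category = category +
  assumes Unit_closed: "Unit C \<in> Obj C"
    and TensorO_closed: "\<lbrakk>A \<in> Obj C; B \<in> Obj C\<rbrakk> \<Longrightarrow> A \<odot> B \<in> Obj C"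
    and TensorO_assoc: "\<lbrakk>A \<in> Obj C; B \<in> Obj C; D \<in> Obj C\<rbrakk> \<Longrightarrow> (A \<odot> B) \<odot> D = A \<odot> (B \<odot> D)"
    and TensorO_Unit_left: "A \<in> Obj C \<Longrightarrow> Unit C \<odot> A = A"
    and TensorO_Unit_right: "A \<in> Obj C \<Longrightarrow> A \<odot> Unit C = A"
    and TensorA_closed: "\<lbrakk>f \<in> Hom C A B; g \<in> Hom C A' B'\<rbrakk>
          \<Longrightarrow> f \<boxtimes> g \<in> Hom C (A \<odot> A') (B \<odot> B')"
    and TensorA_Ident: "\<lbrakk>A \<in> Obj C; B \<in> Obj C\<rbrakk> \<Longrightarrow> Ident C A \<boxtimes> Ident C B = Ident C (A \<odot> B)"
    and interchange: "\<lbrakk>f \<in> Hom C A B; g \<in> Hom C B D; f' \<in> Hom C A' B'; g' \<in> Hom C B' D'\<rbrakk>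
          \<Longrightarrow> (g \<cdot> f) \<boxtimes> (g' \<cdot> f') = (g \<boxtimes> g') \<cdot> (f \<boxtimes> f')"
    and TensorA_assoc: "\<lbrakk>f \<in> Arr C; g \<in> Arr C; h \<in> Arr C\<rbrakk> \<Longrightarrow> (f \<boxtimes> g) \<boxtimes> h = f \<boxtimes> (g \<boxtimes> h)"
    and TensorA_Unit_left: "f \<in> Arr C \<Longrightarrow> Ident C (Unit C) \<boxtimes> f = f"
    and TensorA_Unit_right: "f \<in> Arr C \<Longrightarrow> f \<boxtimes> Ident C (Unit C) = f"

definition inverse_arrows :: "('o, 'm, 'x) strict_monoidal_scheme \<Rightarrow> 'm \<Rightarrow> 'm \<Rightarrow> bool"
  where "inverse_arrows C f g \<longleftrightarrow>
    f \<in> Arr C \<and> g \<in> Hom C (Cod C f) (Dom C f) \<and>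
    g \<cdot>\<^bsub>C\<^esub> f = Ident C (Dom C f) \<and> f \<cdot>\<^bsub>C\<^esub> g = Ident C (Cod C f)"

definition invertible_arrow :: "('o, 'm, 'x) strict_monoidal_scheme \<Rightarrow> 'm \<Rightarrow> bool"
  where "invertible_arrow C f \<longleftrightarrow> (\<exists>g. inverse_arrows C f g)"

definition inv_arrow :: "('o, 'm, 'x) strict_monoidal_scheme \<Rightarrow> 'm \<Rightarrow> 'm"
  where "inv_arrow C f = (THE g. inverse_arrows C f g)"

locale braided_category = strict_monoidal_category C
  for C :: "('o, 'm, 'x) braided_monoidal_scheme" (structure) +
  assumes Braid_closed: "\<lbrakk>A \<in> Obj C; B \<in> Obj C\<rbrakk> \<Longrightarrow> Braid C A B \<in> Hom C (A \<odot> B) (B \<odot> A)"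
    and Braid_invertible: "\<lbrakk>A \<in> Obj C; B \<in> Obj C\<rbrakk> \<Longrightarrow> invertible_arrow C (Braid C A B)"
    and Braid_natural: "\<lbrakk>f \<in> Hom C A A'; g \<in> Hom C B B'\<rbrakk>
          \<Longrightarrow> Braid C A' B' \<cdot> (f \<boxtimes> g) = (g \<boxtimes> f) \<cdot> Braid C A B"
    and Braid_tensor_right: "\<lbrakk>V \<in> Obj C; W \<in> Obj C; U \<in> Obj C\<rbrakk>
          \<Longrightarrow> Braid C V (W \<odot> U) = (Ident C W \<boxtimes> Braid C V U) \<cdot> (Braid C V W \<boxtimes> Ident C U)"
    and Braid_tensor_left: "\<lbrakk>V \<in> Obj C; W \<in> Obj C; U \<in> Obj C\<rbrakk>
          \<Longrightarrow> Braid C (V \<odot> W) U = (Braid C V U \<boxtimes> Ident C W) \<cdot> (Ident C V \<boxtimes> Braid C W U)"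

locale symmetric_category = braided_category +
  assumes Braid_symmetric: "\<lbrakk>V \<in> Obj C; W \<in> Obj C\<rbrakk>
          \<Longrightarrow> Braid C V W \<cdot> Braid C W V = Ident C (W \<odot> V)"

definition braided_object :: "('o, 'm, 'x) strict_monoidal_scheme \<Rightarrow> 'o \<Rightarrow> 'm \<Rightarrow> bool"
  where "braided_object C V s \<longleftrightarrow>
    V \<in> Obj C \<and> s \<in> Hom C (V \<odot>\<^bsub>C\<^esub> V) (V \<odot>\<^bsub>C\<^esub> V) \<and> invertible_arrow C s \<and>
    (s \<boxtimes>\<^bsub>C\<^esub> Ident C V) \<cdot>\<^bsub>C\<^esub> (Ident C V \<boxtimes>\<^bsub>C\<^esub> s) \<cdot>\<^bsub>C\<^esub> (s \<boxtimes>\<^bsub>C\<^esub> Ident C V) =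
    (Ident C V \<boxtimes>\<^bsub>C\<^esub> s) \<cdot>\<^bsub>C\<^esub> (s \<boxtimes>\<^bsub>C\<^esub> Ident C V) \<cdot>\<^bsub>C\<^esub> (Ident C V \<boxtimes>\<^bsub>C\<^esub> s)"

primrec obj_power :: "('o, 'm, 'x) strict_monoidal_scheme \<Rightarrow> 'o \<Rightarrow> nat \<Rightarrow> 'o"
  where
    "obj_power C V 0 = Unit C"
  | "obj_power C V (Suc n) = V \<odot>\<^bsub>C\<^esub> obj_power C V n"

primrec arr_power :: "('o, 'm, 'x) strict_monoidal_scheme \<Rightarrow> 'm \<Rightarrow> nat \<Rightarrow> 'm"
  where
    "arr_power C f 0 = Ident C (Unit C)"
  | "arr_power C f (Suc n) = f \<boxtimes>\<^bsub>C\<^esub> arr_power C f n"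

definition End_monoid :: "('o, 'm, 'x) strict_monoidal_scheme \<Rightarrow> 'o \<Rightarrow> 'm monoid"
  where "End_monoid C A = \<lparr>carrier = Hom C A A, mult = Comp C, one = Ident C A\<rparr>"


section \<open>Free symmetric categories on a braided object\<close>

text \<open>A functor is a pair of an object map and an arrow map.  Both are required to be
  extensional (undefined outside \<open>Obj\<close>, resp. \<open>Arr\<close>), so that equality of functors is
  equality of pairs.\<close>

definition symmetric_functor ::
    "('o, 'm, 'x) braided_monoidal_scheme \<Rightarrow> ('p, 'q, 'y) braided_monoidal_scheme
      \<Rightarrow> ('o \<Rightarrow> 'p) \<times> ('m \<Rightarrow> 'q) \<Rightarrow> bool"
  where "symmetric_functor C D F \<longleftrightarrow> (case F of (Fo, Fa) \<Rightarrow>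
    Fo \<in> Obj C \<rightarrow>\<^sub>E Obj D \<and> Fa \<in> Arr C \<rightarrow>\<^sub>E Arr D \<and>
    (\<forall>f \<in> Arr C. Dom D (Fa f) = Fo (Dom C f) \<and> Cod D (Fa f) = Fo (Cod C f)) \<and>
    (\<forall>A \<in> Obj C. Fa (Ident C A) = Ident D (Fo A)) \<and>
    (\<forall>f \<in> Arr C. \<forall>g \<in> Arr C. Dom C g = Cod C f \<longrightarrow> Fa (g \<cdot>\<^bsub>C\<^esub> f) = Fa g \<cdot>\<^bsub>D\<^esub> Fa f) \<and>
    Fo (Unit C) = Unit D \<and>
    (\<forall>A \<in> Obj C. \<forall>B \<in> Obj C. Fo (A \<odot>\<^bsub>C\<^esub> B) = Fo A \<odot>\<^bsub>D\<^esub> Fo B) \<and>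
    (\<forall>f \<in> Arr C. \<forall>g \<in> Arr C. Fa (f \<boxtimes>\<^bsub>C\<^esub> g) = Fa f \<boxtimes>\<^bsub>D\<^esub> Fa g) \<and>
    (\<forall>A \<in> Obj C. \<forall>B \<in> Obj C. Fa (Braid C A B) = Braid D (Fo A) (Fo B)))"

definition universal_among ::
    "('p \<times> 'q) itself \<Rightarrow> ('o, 'm) braided_monoidal \<Rightarrow> 'o \<Rightarrow> 'm \<Rightarrow> bool"
  where "universal_among T C V s \<longleftrightarrow>
    (\<forall>(D :: ('p, 'q) braided_monoidal) W t.
      symmetric_category D \<and> braided_object D W t \<longrightarrow>
      (\<exists>!F. symmetric_functor C D F \<and> fst F V = W \<and> snd F s = t))"

text \<open>The universal property ranges over all symmetric categories \<open>D\<close>, but a HOL formula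
  cannot quantify over the types of the objects and arrows of \<open>D\<close>.  Two instances are
  required: \<open>D\<close> living in the same types as \<open>C\<close>, and \<open>D\<close> with objects and arrows encoded
  as natural numbers, i.e. all countable \<open>D\<close>.  The free symmetric category is itself
  countable, so the second instance makes it a possible target \<open>D\<close>, and the uniqueness
  part of the first one then makes \<open>C\<close> isomorphic to it.  Requiring more instances
  would therefore not change the notion.\<close>

definition free_symmetric_category ::
    "('o, 'm) braided_monoidal \<Rightarrow> 'o \<Rightarrow> 'm \<Rightarrow> bool"
  where "free_symmetric_category C V s \<longleftrightarrow>
    symmetric_category C \<and> braided_object C V s \<and>
    universal_among TYPE('o \<times> 'm) C V s \<and> universal_among TYPE(nat \<times> nat) C V s"


section \<open>Groups given by generators and relations\<close>

text \<open>A letter \<open>(True, x)\<close> stands for the generator \<open>x\<close>, and \<open>(False, x)\<close> for its formal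
  inverse.\<close>

type_synonym 'x word = "(bool \<times> 'x) list"

definition words :: "'x set \<Rightarrow> 'x word set"
  where "words X = lists (UNIV \<times> X)"

inductive pres_eq :: "'x set \<Rightarrow> ('x word \<times> 'x word) set \<Rightarrow> 'x word \<Rightarrow> 'x word \<Rightarrow> bool"
  for X :: "'x set" and R :: "('x word \<times> 'x word) set"
  where
    pres_refl: "w \<in> words X \<Longrightarrow> pres_eq X R w w"
  | pres_sym: "pres_eq X R u v \<Longrightarrow> pres_eq X R v u"
  | pres_trans: "\<lbrakk>pres_eq X R u v; pres_eq X R v w\<rbrakk> \<Longrightarrow> pres_eq X R u w"
  | pres_cancel: "\<lbrakk>x \<in> X; u \<in> words X; v \<in> words X\<rbrakk>
      \<Longrightarrow> pres_eq X R (u @ [(b, x), (\<not> b, x)] @ v) (u @ v)"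
  | pres_rel: "\<lbrakk>(l, r) \<in> R; u \<in> words X; v \<in> words X\<rbrakk>
      \<Longrightarrow> pres_eq X R (u @ l @ v) (u @ r @ v)"

definition pres_class :: "'x set \<Rightarrow> ('x word \<times> 'x word) set \<Rightarrow> 'x word \<Rightarrow> 'x word set"
  where "pres_class X R w = {v. pres_eq X R w v}"

definition presented_group :: "'x set \<Rightarrow> ('x word \<times> 'x word) set \<Rightarrow> 'x word set monoid"
  where "presented_group X R =
    \<lparr>carrier = pres_class X R ` words X,
     mult = (\<lambda>a b. {w. \<exists>u \<in> a. \<exists>v \<in> b. pres_eq X R (u @ v) w}),
     one = pres_class X R []\<rparr>"

lemma words_append [simp]: "u @ v \<in> words X \<longleftrightarrow> u \<in> words X \<and> v \<in> words X"
  by (auto simp: words_def)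

lemma words_Nil [simp]: "[] \<in> words X"
  by (simp add: words_def)

lemma words_Cons [simp]: "(b, x) # w \<in> words X \<longleftrightarrow> x \<in> X \<and> w \<in> words X"
  by (auto simp: words_def)

lemma pres_eq_words:
  assumes "pres_eq X R u v" and "R \<subseteq> words X \<times> words X"
  shows "u \<in> words X \<and> v \<in> words X"
  using assms by (induction rule: pres_eq.induct) auto

lemma pres_eq_context:
  assumes "pres_eq X R u v" and "p \<in> words X" and "q \<in> words X"
  shows "pres_eq X R (p @ u @ q) (p @ v @ q)"
  using assms
proof (induction rule: pres_eq.induct)
  case (pres_cancel x u v b)
  then show ?case using pres_eq.pres_cancel[of x X "p @ u" "v @ q" R b] by simp
next
  case (pres_rel l r u v)
  then show ?case using pres_eq.pres_rel[of l r R "p @ u" X "v @ q"] by simp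
qed (auto intro: pres_eq.intros)

lemma pres_eq_append:
  assumes "pres_eq X R u u'" and "pres_eq X R v v'" and R: "R \<subseteq> words X \<times> words X"
  shows "pres_eq X R (u @ v) (u' @ v')"
proof -
  have "pres_eq X R (u @ v) (u' @ v)"
    using pres_eq_context[OF assms(1), of "[]" v] pres_eq_words[OF assms(2) R] by simp
  moreover have "pres_eq X R (u' @ v) (u' @ v')"
    using pres_eq_context[OF assms(2), of u' "[]"] pres_eq_words[OF assms(1) R] by simp
  ultimately show ?thesis by (rule pres_trans)
qed

lemma pres_class_eqI: "pres_eq X R u v \<Longrightarrow> pres_class X R u = pres_class X R v"
  by (auto simp: pres_class_def intro: pres_sym pres_trans)

lemma pres_mult:
  assumes "R \<subseteq> words X \<times> words X" and "u \<in> words X" and "v \<in> words X"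
  shows "pres_class X R u \<otimes>\<^bsub>presented_group X R\<^esub> pres_class X R v = pres_class X R (u @ v)"
  using assms
  by (auto simp: presented_group_def pres_class_def intro: pres_refl)
    (blast intro: pres_trans pres_eq_append)

lemma pres_inverse:
  assumes "w \<in> words X"
  shows "\<exists>v \<in> words X. pres_eq X R (v @ w) []"
  using assms
proof (induction w)
  case Nil
  show ?case by (auto intro!: bexI[of _ "[]"] pres_refl)
next
  case (Cons a w)
  obtain b x where a: "a = (b, x)" by (cases a)
  with Cons obtain v where v: "v \<in> words X" "pres_eq X R (v @ w) []" by auto
  have "pres_eq X R ((v @ [(\<not> b, x)]) @ a # w) (v @ w)"
    using pres_cancel[of x X v w R "\<not> b"] Cons.prems v a by simp
  with v(2) have "pres_eq X R ((v @ [(\<not> b, x)]) @ a # w) []" by (blast intro: pres_trans)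
  moreover have "v @ [(\<not> b, x)] \<in> words X" using v Cons.prems a by simp
  ultimately show ?case by blast
qed

lemma group_presented_group:
  assumes R: "R \<subseteq> words X \<times> words X"
  shows "group (presented_group X R)"
proof (rule groupI)
  have c: "carrier (presented_group X R) = pres_class X R ` words X"
    and o: "\<one>\<^bsub>presented_group X R\<^esub> = pres_class X R []"
    by (simp_all add: presented_group_def)
  show "\<one>\<^bsub>presented_group X R\<^esub> \<in> carrier (presented_group X R)"
    by (simp add: c o)
  fix a assume a: "a \<in> carrier (presented_group X R)"
  then obtain u where u: "u \<in> words X" "a = pres_class X R u" by (auto simp: c)
  show "\<one>\<^bsub>presented_group X R\<^esub> \<otimes>\<^bsub>presented_group X R\<^esub> a = a"
    using u by (simp add: o pres_mult[OF R])
  obtain v where v: "v \<in> words X" "pres_eq X R (v @ u) []" using pres_inverse u by blast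
  then show "\<exists>y \<in> carrier (presented_group X R).
      y \<otimes>\<^bsub>presented_group X R\<^esub> a = \<one>\<^bsub>presented_group X R\<^esub>"
    using u by (auto simp: c o pres_mult[OF R] intro!: bexI[of _ v] pres_class_eqI)
  fix b assume b: "b \<in> carrier (presented_group X R)"
  then obtain u' where u': "u' \<in> words X" "b = pres_class X R u'" by (auto simp: c)
  show "a \<otimes>\<^bsub>presented_group X R\<^esub> b \<in> carrier (presented_group X R)"
    using u u' by (simp add: c pres_mult[OF R])
  fix d assume d: "d \<in> carrier (presented_group X R)"
  then obtain u'' where u'': "u'' \<in> words X" "d = pres_class X R u''" by (auto simp: c)
  show "a \<otimes>\<^bsub>presented_group X R\<^esub> b \<otimes>\<^bsub>presented_group X R\<^esub> d =
      a \<otimes>\<^bsub>presented_group X R\<^esub> (b \<otimes>\<^bsub>presented_group X R\<^esub> d)"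
    using u u' u'' by (simp add: pres_mult[OF R])
qed


section \<open>Virtual braid groups\<close>

datatype vb_gen = Sigma_gen nat | Zeta_gen nat

definition vb_gens :: "nat \<Rightarrow> vb_gen set"
  where "vb_gens n = Sigma_gen ` {1..<n} \<union> Zeta_gen ` {1..<n}"

abbreviation (input) sig :: "nat \<Rightarrow> bool \<times> vb_gen"
  where "sig i \<equiv> (True, Sigma_gen i)"

abbreviation (input) zet :: "nat \<Rightarrow> bool \<times> vb_gen"
  where "zet i \<equiv> (True, Zeta_gen i)"

definition far_apart :: "nat \<Rightarrow> nat \<Rightarrow> nat \<Rightarrow> bool"
  where "far_apart n i j \<longleftrightarrow> i \<in> {1..<n} \<and> j \<in> {1..<n} \<and> \<bar>int i - int j\<bar> > 1"

definition vb_rels :: "nat \<Rightarrow> (vb_gen word \<times> vb_gen word) set"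
  where "vb_rels n =
      {([sig i, sig j], [sig j, sig i]) | i j. far_apart n i j}
    \<union> {([sig i, sig (i + 1), sig i], [sig (i + 1), sig i, sig (i + 1)]) | i. 1 \<le> i \<and> i + 1 < n}
    \<union> {([zet i, zet j], [zet j, zet i]) | i j. far_apart n i j}
    \<union> {([zet i, zet (i + 1), zet i], [zet (i + 1), zet i, zet (i + 1)]) | i. 1 \<le> i \<and> i + 1 < n}
    \<union> {([zet i, zet i], []) | i. i \<in> {1..<n}}
    \<union> {([sig i, zet j], [zet j, sig i]) | i j. far_apart n i j}
    \<union> {([zet i, zet (i + 1), sig i], [sig (i + 1), zet i, zet (i + 1)]) | i. 1 \<le> i \<and> i + 1 < n}"

definition VB :: "nat \<Rightarrow> vb_gen word set monoid"
  where "VB n = presented_group (vb_gens n) (vb_rels n)"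

definition vb_sigma :: "nat \<Rightarrow> nat \<Rightarrow> vb_gen word set"
  where "vb_sigma n i = pres_class (vb_gens n) (vb_rels n) [sig i]"

definition vb_zeta :: "nat \<Rightarrow> nat \<Rightarrow> vb_gen word set"
  where "vb_zeta n i = pres_class (vb_gens n) (vb_rels n) [zet i]"

lemma group_VB: "group (VB n)"
  unfolding VB_def
  by (rule group_presented_group) (auto simp: vb_rels_def vb_gens_def far_apart_def)

end

(* The words of all the virtual braid groups, juxtaposed by shifting indices, form a strict
   symmetric category whose objects are natural numbers, with the permutation words in the
   zeta_i as braiding, and sigma_1 makes the object 1 a braided object.  The universal property
   gives a functor F from C to this category.  Conversely, the relations of VB_n hold in C, so
   evaluating words is a symmetric functor G to C.  On VB_n, F after G is the identity by
   inspection of the generators; G after F is the identity on C by uniqueness.  Hence evaluation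
   is bijective from VB_n onto End(V^n). *)

theory Submission
  imports Defs "HOL-Library.Countable"
begin

section \<open>Words modulo relations\<close>

text \<open>The obstacle is the symmetry of the virtual braid category: a permutation word in the
  zetas has to be natural against every virtual braid, sigmas included. Moving one letter past one
  strand at a time reduces this to a generator that meets two consecutive zetas, and there it is
  relation (3) for a sigma and the braid relation for a zeta. The commutation of distant generators
  gives the interchange law. In the other direction, both local relations are naturality of the
  braiding of \<open>V \<odot> V\<close> with \<open>V\<close>, taken against sigma and against the
  braiding itself. The two instances of the universal property serve different ends: arrows are
  coded by natural numbers so that the virtual braid category can receive F, while uniqueness is
  used with C as its own target. Words compose in applicative order, so the last letter acts first.
  The work is done on words up to \<open>vb_eq\<close>; classes are formed only for the arrows of
  the category and the elements of the group.\<close>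

declare pres_trans [trans]

text \<open>Multiply the hypothesis by the inverse of \<open>y\<close> on the left and by the
  inverse of \<open>x\<close> on the right. The relations mention positive letters only, and this
  carries their consequences over to formal inverses.\<close>

lemma intertwine_inverse:
  assumes R: "R \<subseteq> words X \<times> words X" and w: "w \<in> words X" and x: "x \<in> X" and y: "y \<in> X"
    and eq: "pres_eq X R (w @ [(True, x)]) ([(True, y)] @ w)"
  shows "pres_eq X R (w @ [(False, x)]) ([(False, y)] @ w)"
proof -
  have "pres_eq X R (w @ [(False, x)]) ([] @ [(False, y), (\<not> False, y)] @ w @ [(False, x)])"
    using pres_sym[OF pres_cancel[of y X "[]" "w @ [(False, x)]" R False]] w x y by simp
  also have "[] @ [(False, y), (\<not> False, y)] @ w @ [(False, x)] =
      [(False, y)] @ ([(True, y)] @ w) @ [(False, x)]"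
    by simp
  also have "pres_eq X R ([(False, y)] @ ([(True, y)] @ w) @ [(False, x)])
      ([(False, y)] @ (w @ [(True, x)]) @ [(False, x)])"
    by (rule pres_eq_context[OF pres_sym[OF eq]]) (simp_all add: x y)
  also have "[(False, y)] @ (w @ [(True, x)]) @ [(False, x)] =
      ([(False, y)] @ w) @ [(True, x), (\<not> True, x)] @ []"
    by simp
  also have "pres_eq X R (([(False, y)] @ w) @ [(True, x), (\<not> True, x)] @ [])
      (([(False, y)] @ w) @ [])"
    by (rule pres_cancel) (simp_all add: w x y)
  finally show ?thesis by simp
qed

text \<open>Moving a word past \<open>w\<close> reduces to moving single positive generators. The
  two relabellings \<open>f\<close> and \<open>g\<close> let a generator change its index on the
  way, as it does when it slides through a crossing strand.\<close>

lemma intertwine: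
  assumes R: "R \<subseteq> words X \<times> words X" and w: "w \<in> words X"
    and f: "\<And>x. x \<in> Y \<Longrightarrow> f x \<in> X" and g: "\<And>x. x \<in> Y \<Longrightarrow> g x \<in> X"
    and eq: "\<And>x. x \<in> Y \<Longrightarrow> pres_eq X R (w @ [(True, f x)]) ([(True, g x)] @ w)"
    and u: "u \<in> words Y"
  shows "pres_eq X R (w @ map (apsnd f) u) (map (apsnd g) u @ w)"
  using u
proof (induction u)
  case Nil
  show ?case using w by (simp add: pres_refl)
next
  case (Cons a u)
  obtain b x where a: "a = (b, x)" by (cases a)
  with Cons.prems have x: "x \<in> Y" and u: "u \<in> words Y" by simp_all
  have fu: "map (apsnd f) u \<in> words X" using u f by (induction u) auto
  have letter: "pres_eq X R (w @ [(b, f x)]) ([(b, g x)] @ w)"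
    using eq[OF x] intertwine_inverse[OF R w f[OF x] g[OF x] eq[OF x]] by (cases b) auto
  have "pres_eq X R (([] @ (w @ [(b, f x)]) @ map (apsnd f) u))
      ([] @ ([(b, g x)] @ w) @ map (apsnd f) u)"
    by (rule pres_eq_context[OF letter]) (simp_all add: fu)
  also have "[] @ ([(b, g x)] @ w) @ map (apsnd f) u = [(b, g x)] @ (w @ map (apsnd f) u) @ []"
    by simp
  also have "pres_eq X R \<dots> ([(b, g x)] @ (map (apsnd g) u @ w) @ [])"
    by (rule pres_eq_context[OF Cons.IH[OF u]]) (simp_all add: g x)
  finally show ?case by (simp add: a)
qed

text \<open>Conjugation by \<open>b\<close> undoes conjugation by \<open>a\<close>; this turns a
  sliding rule into its mirror image.\<close>

lemma intertwine_flip: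
  assumes R: "R \<subseteq> words X \<times> words X"
    and ab: "pres_eq X R (a @ b) []" and ba: "pres_eq X R (b @ a) []"
    and eq: "pres_eq X R (a @ u) (v @ a)"
  shows "pres_eq X R (b @ v) (u @ b)"
proof -
  have W: "a \<in> words X" "b \<in> words X" "u \<in> words X" "v \<in> words X"
    using pres_eq_words[OF ab R] pres_eq_words[OF eq R] by simp_all
  have "pres_eq X R (b @ v) ((b @ v) @ a @ b)"
    using pres_eq_context[OF pres_sym[OF ab], of "b @ v" "[]"] W by simp
  also have "(b @ v) @ a @ b = b @ (v @ a) @ b" by simp
  also have "pres_eq X R \<dots> (b @ (a @ u) @ b)"
    by (rule pres_eq_context[OF pres_sym[OF eq]]) (simp_all add: W)
  also have "b @ (a @ u) @ b = [] @ (b @ a) @ u @ b" by simp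
  also have "pres_eq X R \<dots> ([] @ [] @ u @ b)"
    by (rule pres_eq_context[OF ba]) (simp_all add: W)
  finally show ?thesis by simp
qed


section \<open>Juxtaposition of virtual braids\<close>

abbreviation vb_words :: "nat \<Rightarrow> vb_gen word set"
  where "vb_words n \<equiv> words (vb_gens n)"

abbreviation vb_eq :: "nat \<Rightarrow> vb_gen word \<Rightarrow> vb_gen word \<Rightarrow> bool"
  where "vb_eq n \<equiv> pres_eq (vb_gens n) (vb_rels n)"

primrec shift_gen :: "nat \<Rightarrow> vb_gen \<Rightarrow> vb_gen"
  where
    "shift_gen k (Sigma_gen i) = Sigma_gen (k + i)"
  | "shift_gen k (Zeta_gen i) = Zeta_gen (k + i)"

text \<open>This is juxtaposition with \<open>k\<close> identity strands on the left. Identity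
  strands added on the right change no index and leave the word as it is.\<close>

definition shift :: "nat \<Rightarrow> vb_gen word \<Rightarrow> vb_gen word"
  where "shift k = map (apsnd (shift_gen k))"

lemma shift_Nil [simp]: "shift k [] = []"
  and shift_Cons [simp]: "shift k ((b, x) # w) = (b, shift_gen k x) # shift k w"
  and shift_append [simp]: "shift k (u @ v) = shift k u @ shift k v"
  by (simp_all add: shift_def)

lemma shift_gen_0 [simp]: "shift_gen 0 = id"
proof
  fix x show "shift_gen 0 x = id x" by (cases x) simp_all
qed

lemma shift_gen_shift_gen [simp]: "shift_gen j (shift_gen k x) = shift_gen (j + k) x"
  by (cases x) simp_all

lemma shift_0 [simp]: "shift 0 w = w"
  by (induction w) auto

lemma shift_shift [simp]: "shift j (shift k w) = shift (j + k) w"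
  by (induction w) auto

lemma vb_rels_words: "vb_rels n \<subseteq> vb_words n \<times> vb_words n"
  by (auto simp: vb_rels_def vb_gens_def far_apart_def)

lemma shift_gen_vb_gens: "x \<in> vb_gens n \<Longrightarrow> k + n \<le> N \<Longrightarrow> shift_gen k x \<in> vb_gens N"
  by (auto simp: vb_gens_def)

lemma shift_words: "w \<in> vb_words n \<Longrightarrow> k + n \<le> N \<Longrightarrow> shift k w \<in> vb_words N"
  by (induction w) (auto simp: shift_gen_vb_gens)

lemma words_mono: "w \<in> vb_words n \<Longrightarrow> n \<le> N \<Longrightarrow> w \<in> vb_words N"
  using shift_words[of w n 0 N] by simp

lemma shift_rels:
  assumes "(l, r) \<in> vb_rels n" and "k + n \<le> N"
  shows "(shift k l, shift k r) \<in> vb_rels N"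
proof -
  have far: "far_apart N (k + i) (k + j)" if "far_apart n i j" for i j
    using that assms(2) by (auto simp: far_apart_def)
  show ?thesis
    using assms unfolding vb_rels_def
    by (elim UnE) (auto intro: far)
qed

lemma shift_eq:
  assumes "vb_eq n u v" and N: "k + n \<le> N"
  shows "vb_eq N (shift k u) (shift k v)"
  using assms(1)
proof (induction rule: pres_eq.induct)
  case (pres_cancel x u v b)
  then show ?case
    using pres_eq.pres_cancel[of "shift_gen k x" "vb_gens N" "shift k u" "shift k v" "vb_rels N" b]
      N shift_words shift_gen_vb_gens by simp
next
  case (pres_rel l r u v)
  then show ?case
    using pres_eq.pres_rel[of "shift k l" "shift k r" "vb_rels N" "shift k u" "vb_gens N" "shift k v"]
      N shift_words shift_rels by simp
qed (auto intro: pres_eq.intros shift_words[OF _ N])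

lemma eq_mono: "vb_eq n u v \<Longrightarrow> n \<le> N \<Longrightarrow> vb_eq N u v"
  using shift_eq[of n u v 0 N] by simp

lemma eq_append: "vb_eq n u u' \<Longrightarrow> vb_eq n v v' \<Longrightarrow> vb_eq n (u @ v) (u' @ v')"
  using pres_eq_append vb_rels_words by blast

lemma eq_rel: "(l, r) \<in> vb_rels n \<Longrightarrow> vb_eq n l r"
  using pres_rel[of l r "vb_rels n" "[]" "vb_gens n" "[]"] by simp

text \<open>One index is below \<open>m\<close> and the other above it, so they differ by at least
  2.\<close>

lemma far_commute_gens:
  assumes "x \<in> vb_gens m" and "y \<in> vb_gens n"
  shows "vb_eq (m + n) [(True, x), (True, shift_gen m y)] [(True, shift_gen m y), (True, x)]"
proof -
  obtain i where i: "1 \<le> i" "i < m" "x = Sigma_gen i \<or> x = Zeta_gen i"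
    using assms(1) by (auto simp: vb_gens_def)
  obtain j where j: "1 \<le> j" "j < n" "y = Sigma_gen j \<or> y = Zeta_gen j"
    using assms(2) by (auto simp: vb_gens_def)
  have far: "far_apart (m + n) i (m + j)" "far_apart (m + n) (m + j) i"
    using i j by (auto simp: far_apart_def)
  \<comment> \<open>The mixed relation is listed only with the sigma on the left, so either
    orientation may be the one that occurs.\<close>
  have "([(True, x), (True, shift_gen m y)], [(True, shift_gen m y), (True, x)]) \<in> vb_rels (m + n)
    \<or> ([(True, shift_gen m y), (True, x)], [(True, x), (True, shift_gen m y)]) \<in> vb_rels (m + n)"
    using i(3) j(3) far by (auto simp: vb_rels_def)
  then show ?thesis using eq_rel pres_sym by blast
qed

text \<open>This becomes the interchange law. \<open>intertwine\<close> is used twice: one letter of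
  \<open>u\<close> passes all of \<open>shift m v\<close>, and then \<open>shift m v\<close> passes
  all of \<open>u\<close>.\<close>

lemma far_commute:
  assumes u: "u \<in> vb_words m" and v: "v \<in> vb_words n" and N: "m + n \<le> N"
  shows "vb_eq N (u @ shift m v) (shift m v @ u)"
proof -
  have gen: "vb_eq (m + n) ([(True, x)] @ shift m v) (shift m v @ [(True, x)])"
    if x: "x \<in> vb_gens m" for x
    unfolding shift_def
  proof (rule intertwine[OF vb_rels_words _ _ _ _ v])
    show "[(True, x)] \<in> vb_words (m + n)" using x shift_gen_vb_gens[of x m 0 "m + n"] by simp
    show "vb_eq (m + n) ([(True, x)] @ [(True, shift_gen m y)]) ([(True, shift_gen m y)] @ [(True, x)])"
      if "y \<in> vb_gens n" for y
      using far_commute_gens[OF x that] by simp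
  qed (auto intro: shift_gen_vb_gens)
  have "vb_eq (m + n) (shift m v @ map (apsnd id) u) (map (apsnd id) u @ shift m v)"
  proof (rule intertwine[OF vb_rels_words _ _ _ _ u])
    show "shift m v \<in> vb_words (m + n)" using v by (rule shift_words) simp
    show "id x \<in> vb_gens (m + n)" "id x \<in> vb_gens (m + n)" if "x \<in> vb_gens m" for x
      using that shift_gen_vb_gens[of x m 0 "m + n"] by simp_all
    show "vb_eq (m + n) (shift m v @ [(True, id x)]) ([(True, id x)] @ shift m v)"
      if "x \<in> vb_gens m" for x
      using pres_sym[OF gen[OF that]] by simp
  qed
  then have "vb_eq (m + n) (u @ shift m v) (shift m v @ u)"
    by (simp add: pres_sym)
  then show ?thesis using N by (rule eq_mono)
qed

lemma zeta_cancel: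
  assumes "1 \<le> i" and "i < n" and "u \<in> vb_words n" and "v \<in> vb_words n"
  shows "vb_eq n (u @ [zet i, zet i] @ v) (u @ v)"
  using pres_rel[of "[zet i, zet i]" "[]" "vb_rels n" u "vb_gens n" v] assms
  by (auto simp: vb_rels_def)

text \<open>The presentation has the slide in the opposite direction, through
  \<open>[zet i, zet (i + 1)]\<close>. The reversed word is its inverse because zetas are
  involutions, so the slide can be flipped. It is the braid relation for \<open>Zeta_gen\<close> and
  the mixed relation for \<open>Sigma_gen\<close>.\<close>

lemma zeta_slide:
  assumes i: "1 \<le> i" "i + 1 < n" and g: "g = Sigma_gen \<or> g = Zeta_gen"
  shows "vb_eq n ([zet (i + 1), zet i] @ [(True, g (i + 1))])
      ([(True, g i)] @ [zet (i + 1), zet i])"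
proof (rule intertwine_flip[OF vb_rels_words])
  have gens: "Zeta_gen i \<in> vb_gens n" "Zeta_gen (i + 1) \<in> vb_gens n"
    using i by (auto simp: vb_gens_def)
  show "vb_eq n ([zet i, zet (i + 1)] @ [zet (i + 1), zet i]) []"
    using zeta_cancel[of "i + 1" n "[zet i]" "[zet i]"] zeta_cancel[of i n "[]" "[]"] i gens
    by (auto intro: pres_trans)
  show "vb_eq n ([zet (i + 1), zet i] @ [zet i, zet (i + 1)]) []"
    using zeta_cancel[of i n "[zet (i + 1)]" "[zet (i + 1)]"] zeta_cancel[of "i + 1" n "[]" "[]"]
      i gens by (auto intro: pres_trans)
  show "vb_eq n ([zet i, zet (i + 1)] @ [(True, g i)]) ([(True, g (i + 1))] @ [zet i, zet (i + 1)])"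
    by (rule eq_rel) (use g i in \<open>auto simp: vb_rels_def\<close>)
qed


section \<open>The symmetry on virtual braids\<close>

text \<open>The word of \<open>Id\<^bsub>k\<^esub> \<otimes> c\<^bsub>1,n\<^esub>\<close>, as forced by the hexagon axioms.\<close>

definition pass_word :: "nat \<Rightarrow> nat \<Rightarrow> vb_gen word"
  where "pass_word k n = rev (map (\<lambda>i. zet i) [k + 1..<k + n + 1])"

text \<open>The rightmost factor acts first: the last of the \<open>m\<close> strands crosses the
  \<open>n\<close> others, then the one before it, and so on.\<close>

definition braid_word :: "nat \<Rightarrow> nat \<Rightarrow> vb_gen word"
  where "braid_word m n = concat (map (\<lambda>k. pass_word k n) [0..<m])"

lemma map_shift_upt: "map f [k + a..<k + b] = map (\<lambda>i. f (k + i)) [a..<b]"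
  by (rule nth_equalityI) (simp_all add: add.assoc)

lemma shift_pass_word [simp]: "shift j (pass_word k n) = pass_word (j + k) n"
proof -
  have "map (\<lambda>i. zet i) [j + k + 1..<j + k + n + 1] = map (\<lambda>i. zet (j + i)) [k + 1..<k + n + 1]"
    using map_shift_upt[of "\<lambda>i. zet i" j "k + 1" "k + n + 1"] by (simp add: add.assoc)
  then show ?thesis by (simp add: pass_word_def shift_def rev_map comp_def)
qed

lemma pass_word_0 [simp]: "pass_word k 0 = []"
  and pass_word_1 [simp]: "pass_word k (Suc 0) = [zet (k + 1)]"
  by (simp_all add: pass_word_def)

lemma pass_word_add: "pass_word k (m + n) = pass_word (k + m) n @ pass_word k m"
proof -
  have "[k + 1..<k + (m + n) + 1] = [k + 1..<k + m + 1] @ [k + m + 1..<k + m + n + 1]"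
    using upt_add_eq_append[of "k + 1" "k + m + 1" n] by (simp add: ac_simps)
  then show ?thesis by (simp add: pass_word_def)
qed

lemma pass_word_words: "k + n < N \<Longrightarrow> pass_word k n \<in> vb_words N"
  by (auto simp: words_def vb_gens_def pass_word_def)

lemma braid_word_0 [simp]: "braid_word 0 n = []"
  and braid_word_1 [simp]: "braid_word (Suc 0) n = pass_word 0 n"
  and braid_word_Suc: "braid_word (Suc m) n = braid_word m n @ pass_word m n"
  by (simp_all add: braid_word_def)

lemma braid_word_add_left: "braid_word (m + k) n = braid_word m n @ shift m (braid_word k n)"
proof (induction k)
  case (Suc k)
  then show ?case by (simp add: braid_word_Suc)
qed simp

lemma braid_word_0_right [simp]: "braid_word m 0 = []"
  by (simp add: braid_word_def)

lemma braid_word_words: "m + n \<le> N \<Longrightarrow> braid_word m n \<in> vb_words N"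
  by (induction m) (auto simp: braid_word_Suc intro: pass_word_words)

text \<open>This is the hexagon in the second argument. The one in the first argument is an equality
  of words, since the word is built strand by strand on that side; here crossings of different
  strands have to be reordered.\<close>

lemma braid_word_add_right:
  "vb_eq (m + n + k) (braid_word m (n + k)) (shift n (braid_word m k) @ braid_word m n)"
proof (induction m)
  case 0
  show ?case by (simp add: pres_refl)
next
  case (Suc m)
  let ?N = "Suc m + n + k"
  have shiftW: "shift n (braid_word m k) \<in> vb_words ?N"
    by (rule shift_words[OF braid_word_words[OF order_refl]]) simp
  have W: "braid_word m n \<in> vb_words ?N"
    "pass_word (m + n) k \<in> vb_words ?N" "pass_word m n \<in> vb_words ?N"
    "braid_word m n \<in> vb_words (m + n)"
    by (auto intro: braid_word_words pass_word_words)
  have "vb_eq ?N (braid_word (Suc m) (n + k)) ((shift n (braid_word m k) @ braid_word m n) @ pass_word m (n + k))"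
    unfolding braid_word_Suc
    by (rule eq_append[OF eq_mono[OF Suc.IH] pres_refl]) (auto intro: pass_word_words)
  also have "(shift n (braid_word m k) @ braid_word m n) @ pass_word m (n + k) =
      shift n (braid_word m k) @ (braid_word m n @ shift (m + n) (pass_word 0 k)) @ pass_word m n"
    by (simp add: pass_word_add)
  \<comment> \<open>One strand crossing \<open>k\<close> others occupies \<open>k + 1\<close>
    strands, all to the right of the \<open>m + n\<close> strands of
    \<open>braid_word m n\<close>.\<close>
  also have "vb_eq ?N \<dots> (shift n (braid_word m k) @ (shift (m + n) (pass_word 0 k) @ braid_word m n)
      @ pass_word m n)"
    by (rule pres_eq_context[OF far_commute[where n = "Suc k"]]) (use W shiftW in \<open>auto intro: pass_word_words\<close>)
  also have "\<dots> = shift n (braid_word (Suc m) k) @ braid_word (Suc m) n"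
    by (simp add: braid_word_Suc add.commute)
  finally show ?case .
qed

text \<open>The two words are zeta_n ... zeta_1 and zeta_1 ... zeta_n, so each product collapses
  from its centre. The new generator of the induction step is outermost in the first product and
  central in the second.\<close>

lemma pass_word_cancel:
  "vb_eq (Suc n) (pass_word 0 n @ braid_word n 1) [] \<and> vb_eq (Suc n) (braid_word n 1 @ pass_word 0 n) []"
proof (induction n)
  case 0
  show ?case by (simp add: pres_refl)
next
  case (Suc n)
  have p: "pass_word 0 (Suc n) = zet (Suc n) # pass_word 0 n"
    using pass_word_add[of 0 n 1] by simp
  have b: "braid_word (Suc n) 1 = braid_word n 1 @ [zet (Suc n)]"
    by (simp add: braid_word_Suc)
  have Z: "[zet (Suc n)] \<in> vb_words (Suc (Suc n))"
    by (simp add: vb_gens_def)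
  have W: "braid_word n 1 \<in> vb_words (Suc (Suc n))" "pass_word 0 n \<in> vb_words (Suc (Suc n))"
    by (auto intro: braid_word_words pass_word_words)
  have "vb_eq (Suc (Suc n)) ([zet (Suc n)] @ (pass_word 0 n @ braid_word n 1) @ [zet (Suc n)])
      ([zet (Suc n)] @ [] @ [zet (Suc n)])"
    by (rule pres_eq_context[OF eq_mono[OF conjunct1[OF Suc.IH]]]) (use Z in simp_all)
  also have "vb_eq (Suc (Suc n)) ([zet (Suc n)] @ [] @ [zet (Suc n)]) []"
    using zeta_cancel[of "Suc n" "Suc (Suc n)" "[]" "[]"] by simp
  finally have 1: "vb_eq (Suc (Suc n)) (pass_word 0 (Suc n) @ braid_word (Suc n) 1) []"
    unfolding p b by simp
  have "vb_eq (Suc (Suc n)) (braid_word n 1 @ [zet (Suc n), zet (Suc n)] @ pass_word 0 n)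
      (braid_word n 1 @ pass_word 0 n)"
    by (rule zeta_cancel) (use W in auto)
  also have "vb_eq (Suc (Suc n)) \<dots> []"
    by (rule eq_mono[OF conjunct2[OF Suc.IH]]) simp
  finally have 2: "vb_eq (Suc (Suc n)) (braid_word (Suc n) 1 @ pass_word 0 (Suc n)) []"
    unfolding p b by simp
  from 1 2 show ?case ..
qed

text \<open>Peel the first of the \<open>Suc m\<close> strands off both factors, with one hexagon
  each. A shifted copy of the product for \<open>m\<close> stands in the middle; once it cancels, a
  single strand crosses and returns.\<close>

lemma braid_word_cancel: "vb_eq (m + n) (braid_word m n @ braid_word n m) []"
proof (induction m)
  case 0
  show ?case by (simp add: pres_refl)
next
  case (Suc m)
  let ?N = "Suc m + n"
  have W: "pass_word 0 n \<in> vb_words ?N" "shift 1 (braid_word m n) \<in> vb_words ?N"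
    "braid_word n 1 \<in> vb_words ?N"
    by (auto intro: shift_words[OF braid_word_words[OF order_refl]] braid_word_words pass_word_words)
  have "vb_eq ?N (braid_word (Suc m) n @ braid_word n (Suc m))
      ((pass_word 0 n @ shift 1 (braid_word m n)) @ (shift 1 (braid_word n m) @ braid_word n 1))"
    using braid_word_add_left[of 1 m n] eq_mono[OF braid_word_add_right[of n 1 m], of ?N] W
    by (intro eq_append) (auto intro: pres_refl)
  also have "\<dots> = pass_word 0 n @ (shift 1 (braid_word m n @ braid_word n m)) @ braid_word n 1"
    by simp
  also have "vb_eq ?N \<dots> (pass_word 0 n @ shift 1 [] @ braid_word n 1)"
    by (rule pres_eq_context[OF shift_eq[OF Suc.IH]]) (use W in auto)
  also have "\<dots> = pass_word 0 n @ braid_word n 1" by simp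
  also have "vb_eq ?N \<dots> []"
    by (rule eq_mono[OF conjunct1[OF pass_word_cancel]]) simp
  finally show ?case .
qed

text \<open>Of the zetas of the crossing strand only numbers \<open>i\<close> and
  \<open>i + 1\<close> meet the generator, and \<open>zeta_slide\<close> handles them. The zetas
  acting earlier are far from index \<open>i + 1\<close>, those acting later are far from index
  \<open>i\<close>.\<close>

lemma pass_word_slide:
  assumes x: "x \<in> vb_gens n"
  shows "vb_eq (Suc n) (pass_word 0 n @ [(True, shift_gen 1 x)]) ([(True, x)] @ pass_word 0 n)"
proof -
  obtain g i where i: "1 \<le> i" "i < n" and g: "g = Sigma_gen \<or> g = Zeta_gen" and xg: "x = g i"
    using x that[of _ Sigma_gen] that[of _ Zeta_gen] by (auto simp: vb_gens_def)
  \<comment> \<open>\<open>l\<close> counts the zetas above \<open>i + 1\<close>, and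
    \<open>j\<close> those below \<open>i\<close>.\<close>
  obtain l where n: "n = i + 1 + l" using i by (metis Suc_eq_plus1 Suc_leI le_Suc_ex)
  obtain j where j: "i = j + 1" using i by (metis add.commute le_Suc_ex One_nat_def)
  have sh: "shift_gen k (g a) = g (k + a)" for k a using g by auto
  have gin: "g a \<in> vb_gens N" if "1 \<le> a" "a < N" for a N using that g by (auto simp: vb_gens_def)
  let ?P = "pass_word (i + 1) l" and ?Q = "pass_word 0 j"
  have split: "pass_word 0 n = ?P @ [zet (i + 1), zet i] @ ?Q"
    using pass_word_add[of 0 "i + 1" l] pass_word_add[of 0 i 1] pass_word_add[of 0 j 1]
    by (simp add: n j)
  have Z: "Zeta_gen i \<in> vb_gens (Suc n)" "Zeta_gen (i + 1) \<in> vb_gens (Suc n)"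
    using i by (auto simp: vb_gens_def)
  have W: "?P \<in> vb_words (Suc n)" "?Q \<in> vb_words (Suc n)" "[zet (i + 1), zet i] \<in> vb_words (Suc n)"
    using Z by (auto simp: n j intro: pass_word_words)
  have "vb_eq (Suc n) ((?P @ [zet (i + 1), zet i]) @ (?Q @ shift i [(True, g 1)]) @ [])
      ((?P @ [zet (i + 1), zet i]) @ (shift i [(True, g 1)] @ ?Q) @ [])"
    by (rule pres_eq_context[OF far_commute[where n = 2]])
      (use W in \<open>auto simp: n j intro: pass_word_words gin\<close>)
  also have "\<dots> = ?P @ ([zet (i + 1), zet i] @ [(True, g (i + 1))]) @ ?Q"
    by (simp add: sh)
  also have "vb_eq (Suc n) \<dots> (?P @ ([(True, g i)] @ [zet (i + 1), zet i]) @ ?Q)"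
    by (rule pres_eq_context[OF zeta_slide[OF _ _ g]]) (use i W in auto)
  also have "\<dots> = [] @ (shift (i + 1) (pass_word 0 l) @ [(True, g i)]) @ [zet (i + 1), zet i] @ ?Q"
    by simp
  also have "vb_eq (Suc n) \<dots>
      ([] @ ([(True, g i)] @ shift (i + 1) (pass_word 0 l)) @ [zet (i + 1), zet i] @ ?Q)"
    by (rule pres_eq_context[OF pres_sym[OF far_commute[where n = "Suc l"]]])
      (use W i in \<open>auto simp: n intro: pass_word_words gin\<close>)
  finally show ?thesis unfolding split by (simp add: xg sh)
qed

text \<open>Each of the \<open>m\<close> strands crossed by the letters of \<open>v\<close> lowers
  their indices by one, from a shift by \<open>m\<close> down to none.\<close>

lemma braid_word_slide_right:
  assumes v: "v \<in> vb_words n"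
  shows "vb_eq (m + n) (braid_word m n @ shift m v) (v @ braid_word m n)"
proof (induction m)
  case 0
  show ?case using v by (simp add: pres_refl)
next
  case (Suc m)
  let ?N = "Suc m + n"
  have "vb_eq (Suc n) (pass_word 0 n @ map (apsnd (shift_gen 1)) v) (map (apsnd id) v @ pass_word 0 n)"
  proof (rule intertwine[OF vb_rels_words _ _ _ _ v])
    show "vb_eq (Suc n) (pass_word 0 n @ [(True, shift_gen 1 x)]) ([(True, id x)] @ pass_word 0 n)"
      if "x \<in> vb_gens n" for x using pass_word_slide[OF that] by simp
    show "id x \<in> vb_gens (Suc n)" if "x \<in> vb_gens n" for x
      using shift_gen_vb_gens[OF that, of 0] by simp
  qed (auto intro: shift_gen_vb_gens pass_word_words)
  then have "vb_eq (Suc n) (pass_word 0 n @ shift 1 v) (v @ pass_word 0 n)"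
    by (simp add: shift_def)
  from shift_eq[OF this, of m ?N]
  have slide: "vb_eq ?N (pass_word m n @ shift (Suc m) v) (shift m v @ pass_word m n)" by simp
  have W: "braid_word m n \<in> vb_words ?N" "pass_word m n \<in> vb_words ?N"
    by (auto intro: braid_word_words pass_word_words)
  have "vb_eq ?N (braid_word m n @ (pass_word m n @ shift (Suc m) v))
      (braid_word m n @ (shift m v @ pass_word m n))"
    by (intro eq_append slide pres_refl W)
  also have "\<dots> = (braid_word m n @ shift m v) @ pass_word m n" by simp
  also have "vb_eq ?N \<dots> ((v @ braid_word m n) @ pass_word m n)"
    by (intro eq_append eq_mono[OF Suc.IH] pres_refl W) simp
  finally show ?case by (simp add: braid_word_Suc)
qed

text \<open>\<open>braid_word n m\<close> inverts \<open>braid_word m n\<close>, so this is the flip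
  of the slide on the other side with \<open>m\<close> and \<open>n\<close> exchanged.\<close>

lemma braid_word_slide_left:
  assumes u: "u \<in> vb_words m"
  shows "vb_eq (m + n) (braid_word m n @ u) (shift n u @ braid_word m n)"
  using braid_word_cancel[of m n] braid_word_cancel[of n m] braid_word_slide_right[OF u, of n]
  by (auto simp: add.commute intro: intertwine_flip[OF vb_rels_words])

lemma braid_word_natural:
  assumes u: "u \<in> vb_words m" and v: "v \<in> vb_words n"
  shows "vb_eq (m + n) (braid_word m n @ u @ shift m v) (v @ shift n u @ braid_word m n)"
proof -
  have W: "shift m v \<in> vb_words (m + n)" "shift n u \<in> vb_words (m + n)"
    using u v by (auto intro: shift_words)
  have "vb_eq (m + n) ((braid_word m n @ u) @ shift m v) ((shift n u @ braid_word m n) @ shift m v)"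
    by (intro eq_append braid_word_slide_left u pres_refl W)
  also have "\<dots> = shift n u @ braid_word m n @ shift m v" by simp
  also have "vb_eq (m + n) \<dots> (shift n u @ v @ braid_word m n)"
    by (intro eq_append braid_word_slide_right v pres_refl W)
  also have "\<dots> = (shift n u @ v) @ braid_word m n" by simp
  also have "vb_eq (m + n) \<dots> ((v @ shift n u) @ braid_word m n)"
    by (intro eq_append pres_sym[OF far_commute[OF v u]] pres_refl braid_word_words) simp_all
  finally show ?thesis by simp
qed


section \<open>The symmetric category of virtual braids\<close>

text \<open>Arrows are coded as natural numbers, so that this category is a legitimate target in the
  universal property.\<close>

instance vb_gen :: countable
  by countable_datatype

text \<open>The representative is chosen from the predicate \<open>vb_eq n w\<close>, which depends
  only on the class, so equivalent words get the same code. The degree is stored because one word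
  represents braids on different numbers of strands.\<close>

definition vb_arr :: "nat \<Rightarrow> vb_gen word \<Rightarrow> nat"
  where "vb_arr n w = to_nat (n, SOME v. vb_eq n w v)"

definition vb_degree :: "nat \<Rightarrow> nat"
  where "vb_degree f = fst (from_nat f :: nat \<times> vb_gen word)"

definition vb_word :: "nat \<Rightarrow> vb_gen word"
  where "vb_word f = snd (from_nat f :: nat \<times> vb_gen word)"

definition vb_cat :: "(nat, nat) braided_monoidal"
  where "vb_cat =
    \<lparr>Obj = UNIV,
     Arr = {vb_arr n w | n w. w \<in> vb_words n},
     Dom = vb_degree,
     Cod = vb_degree,
     Ident = (\<lambda>n. vb_arr n []),
     Comp = (\<lambda>g f. vb_arr (vb_degree f) (vb_word g @ vb_word f)),
     Unit = 0,
     TensorO = (+),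
     TensorA = (\<lambda>f g. vb_arr (vb_degree f + vb_degree g)
       (vb_word f @ shift (vb_degree f) (vb_word g))),
     Braid = (\<lambda>m n. vb_arr (m + n) (braid_word m n))\<rparr>"

lemma vb_degree_arr [simp]: "vb_degree (vb_arr n w) = n"
  by (simp add: vb_degree_def vb_arr_def)

lemma vb_word_arr: "w \<in> vb_words n \<Longrightarrow> vb_eq n w (vb_word (vb_arr n w))"
  unfolding vb_word_def vb_arr_def by (simp add: someI[of "vb_eq n w", OF pres_refl])

lemma vb_arr_eq:
  assumes "vb_eq n u v"
  shows "vb_arr n u = vb_arr n v"
proof -
  have "vb_eq n u = vb_eq n v"
    using assms by (auto simp: fun_eq_iff intro: pres_sym pres_trans)
  then show ?thesis by (simp add: vb_arr_def)
qed

lemma vb_arr_eqD: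
  assumes "vb_arr n u = vb_arr n v" and "u \<in> vb_words n" and "v \<in> vb_words n"
  shows "vb_eq n u v"
  using vb_word_arr[of u n] vb_word_arr[of v n] assms by (metis pres_sym pres_trans)

lemma vb_cat_simps [simp]:
  "Obj vb_cat = UNIV"
  "Dom vb_cat = vb_degree"
  "Cod vb_cat = vb_degree"
  "Ident vb_cat n = vb_arr n []"
  "Unit vb_cat = 0"
  "m \<odot>\<^bsub>vb_cat\<^esub> n = m + n"
  "Braid vb_cat m n = vb_arr (m + n) (braid_word m n)"
  by (simp_all add: vb_cat_def)

lemma Arr_vb_cat: "f \<in> Arr vb_cat \<longleftrightarrow> (\<exists>n. \<exists>w \<in> vb_words n. f = vb_arr n w)"
  by (auto simp: vb_cat_def)

lemma Hom_vb_cat: "f \<in> Hom vb_cat m n \<longleftrightarrow> m = n \<and> (\<exists>w \<in> vb_words n. f = vb_arr n w)"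
  by (auto simp: Hom_def Arr_vb_cat)

lemma vb_arr_Hom [simp]: "w \<in> vb_words n \<Longrightarrow> vb_arr n w \<in> Hom vb_cat n n"
  by (auto simp: Hom_vb_cat)

lemma Comp_vb_cat [simp]:
  assumes "u \<in> vb_words n" and "v \<in> vb_words n"
  shows "vb_arr n u \<cdot>\<^bsub>vb_cat\<^esub> vb_arr n v = vb_arr n (u @ v)"
  using assms
  by (auto simp: vb_cat_def intro!: vb_arr_eq eq_append pres_sym[OF vb_word_arr])

lemma TensorA_vb_cat [simp]:
  assumes u: "u \<in> vb_words m" and v: "v \<in> vb_words n"
  shows "vb_arr m u \<boxtimes>\<^bsub>vb_cat\<^esub> vb_arr n v = vb_arr (m + n) (u @ shift m v)"
proof -
  have "vb_eq (m + n) u (vb_word (vb_arr m u))"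
    using vb_word_arr[OF u] by (rule eq_mono) simp
  moreover have "vb_eq (m + n) (shift m v) (shift m (vb_word (vb_arr n v)))"
    using vb_word_arr[OF v] by (rule shift_eq) simp
  ultimately show ?thesis
    using vb_arr_eq[OF eq_append] by (simp add: vb_cat_def)
qed

lemma tensor_words [simp]: "u \<in> vb_words m \<Longrightarrow> v \<in> vb_words n \<Longrightarrow> u @ shift m v \<in> vb_words (m + n)"
  using words_mono[of u m "m + n"] shift_words[of v n m "m + n"] by simp

lemma strict_monoidal_category_vb_cat: "strict_monoidal_category vb_cat"
proof
  show "Dom vb_cat f \<in> Obj vb_cat" "Cod vb_cat f \<in> Obj vb_cat" for f
    by simp_all
  show "Ident vb_cat A \<in> Hom vb_cat A A" for A
    by simp
  show "g \<cdot>\<^bsub>vb_cat\<^esub> f \<in> Hom vb_cat A D"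
    if "f \<in> Hom vb_cat A B" "g \<in> Hom vb_cat B D" for f g A B D
    using that unfolding Hom_vb_cat by (metis Comp_vb_cat words_append)
  show "f \<cdot>\<^bsub>vb_cat\<^esub> Ident vb_cat A = f" "Ident vb_cat B \<cdot>\<^bsub>vb_cat\<^esub> f = f"
    if "f \<in> Hom vb_cat A B" for f A B
    using that by (auto simp: Hom_vb_cat)
  show "Unit vb_cat \<in> Obj vb_cat"
    and "A \<odot>\<^bsub>vb_cat\<^esub> B \<in> Obj vb_cat"
    and "(A \<odot>\<^bsub>vb_cat\<^esub> B) \<odot>\<^bsub>vb_cat\<^esub> D = A \<odot>\<^bsub>vb_cat\<^esub> (B \<odot>\<^bsub>vb_cat\<^esub> D)"
    and "Unit vb_cat \<odot>\<^bsub>vb_cat\<^esub> A = A"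
    and "A \<odot>\<^bsub>vb_cat\<^esub> Unit vb_cat = A"
    and "Ident vb_cat A \<boxtimes>\<^bsub>vb_cat\<^esub> Ident vb_cat B = Ident vb_cat (A \<odot>\<^bsub>vb_cat\<^esub> B)" for A B D
    by simp_all
  show "f \<boxtimes>\<^bsub>vb_cat\<^esub> g \<in> Hom vb_cat (A \<odot>\<^bsub>vb_cat\<^esub> A') (B \<odot>\<^bsub>vb_cat\<^esub> B')"
    if "f \<in> Hom vb_cat A B" "g \<in> Hom vb_cat A' B'" for f g A B A' B'
    using that unfolding Hom_vb_cat vb_cat_simps by (metis TensorA_vb_cat tensor_words)
  show "Ident vb_cat (Unit vb_cat) \<boxtimes>\<^bsub>vb_cat\<^esub> f = f"
    and "f \<boxtimes>\<^bsub>vb_cat\<^esub> Ident vb_cat (Unit vb_cat) = f" if "f \<in> Arr vb_cat" for f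
    using that by (auto simp: Arr_vb_cat)
  show "(h \<cdot>\<^bsub>vb_cat\<^esub> g) \<cdot>\<^bsub>vb_cat\<^esub> f = h \<cdot>\<^bsub>vb_cat\<^esub> (g \<cdot>\<^bsub>vb_cat\<^esub> f)"
    if "f \<in> Hom vb_cat A B" "g \<in> Hom vb_cat B D" "h \<in> Hom vb_cat D E" for f g h A B D E
    using that by (auto simp: Hom_vb_cat)
  show "(f \<boxtimes>\<^bsub>vb_cat\<^esub> g) \<boxtimes>\<^bsub>vb_cat\<^esub> h = f \<boxtimes>\<^bsub>vb_cat\<^esub> (g \<boxtimes>\<^bsub>vb_cat\<^esub> h)"
    if "f \<in> Arr vb_cat" "g \<in> Arr vb_cat" "h \<in> Arr vb_cat" for f g h
    using that by (auto simp: Arr_vb_cat add.assoc simp del: words_append)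
  show "(g \<cdot>\<^bsub>vb_cat\<^esub> f) \<boxtimes>\<^bsub>vb_cat\<^esub> (g' \<cdot>\<^bsub>vb_cat\<^esub> f') =
      (g \<boxtimes>\<^bsub>vb_cat\<^esub> g') \<cdot>\<^bsub>vb_cat\<^esub> (f \<boxtimes>\<^bsub>vb_cat\<^esub> f')"
    if hom: "f \<in> Hom vb_cat A B" "g \<in> Hom vb_cat B D"
      "f' \<in> Hom vb_cat A' B'" "g' \<in> Hom vb_cat B' D'"
    for f g f' g' A B D A' B' D'
  proof -
    obtain u v u' v' where w: "f = vb_arr A u" "g = vb_arr A v" "u \<in> vb_words A" "v \<in> vb_words A"
      "f' = vb_arr A' u'" "g' = vb_arr A' v'" "u' \<in> vb_words A'" "v' \<in> vb_words A'"
      using hom by (auto simp: Hom_vb_cat)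
    \<comment> \<open>The two sides differ only in the order of the middle factors, which live on
      disjoint blocks of strands.\<close>
    have "vb_eq (A + A') (v @ (u @ shift A v') @ shift A u') (v @ (shift A v' @ u) @ shift A u')"
      by (rule pres_eq_context[OF far_commute])
        (use w shift_words[of u' A' A "A + A'"] words_mono[of v A "A + A'"] in auto)
    then show ?thesis
      using w words_append[of v u] tensor_words[of u A u' A'] tensor_words[of v A v' A']
      by (simp add: vb_arr_eq del: tensor_words)
  qed
qed

text \<open>The tensor product of objects is addition, hence commutative: a braiding is an
  endomorphism, and \<open>add.commute\<close> identifies its source with its target.\<close>

lemma symmetric_category_vb_cat: "symmetric_category vb_cat"
proof (intro symmetric_category.intro braided_category.intro symmetric_category_axioms.intro
    braided_category_axioms.intro strict_monoidal_category_vb_cat)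
  have cancel: "Braid vb_cat A B \<cdot>\<^bsub>vb_cat\<^esub> Braid vb_cat B A = Ident vb_cat (B \<odot>\<^bsub>vb_cat\<^esub> A)" for A B
    using braid_word_cancel[of A B] by (simp add: add.commute braid_word_words vb_arr_eq)
  then show "Braid vb_cat A B \<cdot>\<^bsub>vb_cat\<^esub> Braid vb_cat B A = Ident vb_cat (B \<odot>\<^bsub>vb_cat\<^esub> A)" for A B .
  show closed: "Braid vb_cat A B \<in> Hom vb_cat (A \<odot>\<^bsub>vb_cat\<^esub> B) (B \<odot>\<^bsub>vb_cat\<^esub> A)" for A B
    by (simp add: add.commute braid_word_words)
  show "invertible_arrow vb_cat (Braid vb_cat A B)" for A B
    unfolding invertible_arrow_def inverse_arrows_def
    using cancel[of A B] cancel[of B A] closed[of A B] closed[of B A]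
    by (intro exI[of _ "Braid vb_cat B A"]) (simp add: Hom_def add.commute)
  show "Braid vb_cat A' B' \<cdot>\<^bsub>vb_cat\<^esub> (f \<boxtimes>\<^bsub>vb_cat\<^esub> g) = (g \<boxtimes>\<^bsub>vb_cat\<^esub> f) \<cdot>\<^bsub>vb_cat\<^esub> Braid vb_cat A B"
    if hom: "f \<in> Hom vb_cat A A'" "g \<in> Hom vb_cat B B'" for f g A A' B B'
  proof -
    obtain u v where w: "A' = A" "B' = B" "f = vb_arr A u" "g = vb_arr B v"
      "u \<in> vb_words A" "v \<in> vb_words B"
      using hom by (auto simp: Hom_vb_cat)
    show ?thesis
      using braid_word_natural[OF w(5,6)] w tensor_words[OF w(5,6)] tensor_words[OF w(6,5)]
      by (simp add: add.commute[of B A] braid_word_words vb_arr_eq del: tensor_words words_append)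
  qed
  show "Braid vb_cat V (W \<odot>\<^bsub>vb_cat\<^esub> U) = (Ident vb_cat W \<boxtimes>\<^bsub>vb_cat\<^esub> Braid vb_cat V U) \<cdot>\<^bsub>vb_cat\<^esub>
      (Braid vb_cat V W \<boxtimes>\<^bsub>vb_cat\<^esub> Ident vb_cat U)" for V W U
    using braid_word_add_right[of V W U] shift_words[of "braid_word V U" "V + U" W "V + W + U"]
    by (simp add: ac_simps braid_word_words vb_arr_eq)
  show "Braid vb_cat (V \<odot>\<^bsub>vb_cat\<^esub> W) U = (Braid vb_cat V U \<boxtimes>\<^bsub>vb_cat\<^esub> Ident vb_cat W) \<cdot>\<^bsub>vb_cat\<^esub>
      (Ident vb_cat V \<boxtimes>\<^bsub>vb_cat\<^esub> Braid vb_cat W U)" for V W U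
    using shift_words[of "braid_word W U" "W + U" V "V + W + U"]
    by (simp add: ac_simps braid_word_words braid_word_add_left)
qed

lemma inverse_sigma_vb_cat:
  "inverse_arrows vb_cat (vb_arr 2 [sig 1]) (vb_arr 2 [(False, Sigma_gen 1)])"
proof -
  have W: "[sig 1] \<in> vb_words 2" "[(False, Sigma_gen 1)] \<in> vb_words 2"
    by (auto simp: vb_gens_def)
  have cancel: "vb_eq 2 [(b, Sigma_gen 1), (\<not> b, Sigma_gen 1)] []" for b
    using pres_cancel[of "Sigma_gen 1" "vb_gens 2" "[]" "[]" "vb_rels 2" b] by (simp add: vb_gens_def)
  show ?thesis
    using cancel[of True] cancel[of False] W
    by (auto simp: inverse_arrows_def Arr_vb_cat simp del: words_Cons intro!: vb_arr_eq)
qed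

lemma braided_object_vb_cat: "braided_object vb_cat 1 (vb_arr 2 [sig 1])"
proof -
  have W: "[sig 1] \<in> vb_words 2" "[sig 1] \<in> vb_words 3" "[sig 2] \<in> vb_words 3"
    "[sig 1, sig 2] \<in> vb_words 3" "[sig 2, sig 1] \<in> vb_words 3"
    by (auto simp: vb_gens_def)
  have "invertible_arrow vb_cat (vb_arr 2 [sig 1])"
    using inverse_sigma_vb_cat by (auto simp: invertible_arrow_def)
  moreover have "vb_eq 3 [sig 1, sig 2, sig 1] [sig 2, sig 1, sig 2]"
    by (rule eq_rel) (auto simp: vb_rels_def intro!: exI[of _ 1])
  moreover have "vb_arr 2 [sig 1] \<boxtimes>\<^bsub>vb_cat\<^esub> Ident vb_cat 1 = vb_arr 3 [sig 1]"
    "Ident vb_cat 1 \<boxtimes>\<^bsub>vb_cat\<^esub> vb_arr 2 [sig 1] = vb_arr 3 [sig 2]"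
    using W by (simp_all add: numeral_2_eq_2 numeral_3_eq_3 del: words_Cons)
  ultimately show ?thesis
    using W by (auto simp: braided_object_def numeral_2_eq_2[symmetric] vb_arr_eq simp del: words_Cons)
qed

section \<open>Evaluating virtual braids in a symmetric category\<close>

lemma (in category) inv_arrow_eq:
  assumes "inverse_arrows C f g"
  shows "inv_arrow C f = g"
  unfolding inv_arrow_def
proof (rule the_equality)
  show "inverse_arrows C f g" by (rule assms)
  fix h assume h: "inverse_arrows C f h"
  have f: "f \<in> Hom C (Dom C f) (Cod C f)" using assms by (simp add: inverse_arrows_def Hom_def)
  have gh: "g \<in> Hom C (Cod C f) (Dom C f)" "h \<in> Hom C (Cod C f) (Dom C f)"
    using assms h by (simp_all add: inverse_arrows_def)
  have "h = (g \<cdot> f) \<cdot> h"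
    using assms Comp_Ident_left[OF gh(2)] by (simp add: inverse_arrows_def)
  also have "\<dots> = g \<cdot> (f \<cdot> h)" by (rule Comp_assoc[OF gh(2) f gh(1)])
  also have "\<dots> = g" using h Comp_Ident_right[OF gh(1)] by (simp add: inverse_arrows_def)
  finally show "h = g" .
qed

text \<open>The hexagon for the product of two units makes the braiding of the unit with
  \<open>A\<close> idempotent. Symmetry gives it a left inverse, and an idempotent with a left
  inverse is the identity.\<close>

lemma (in symmetric_category) Braid_Unit:
  assumes A: "A \<in> Obj C"
  shows "Braid C (Unit C) A = Ident C A" and "Braid C A (Unit C) = Ident C A"
proof -
  let ?l = "Braid C (Unit C) A" and ?r = "Braid C A (Unit C)"
  have l: "?l \<in> Hom C A A" and r: "?r \<in> Hom C A A"
    using Braid_closed[OF Unit_closed A] Braid_closed[OF A Unit_closed]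
    by (simp_all add: TensorO_Unit_left TensorO_Unit_right A)
  have ll: "?l \<cdot> ?l = ?l"
    using Braid_tensor_left[OF Unit_closed Unit_closed A] l Unit_closed
    by (simp add: TensorO_Unit_left TensorA_Unit_left TensorA_Unit_right Hom_def)
  have rl: "?r \<cdot> ?l = Ident C A"
    using Braid_symmetric[OF A Unit_closed] A by (simp add: TensorO_Unit_left)
  have "?l = (?r \<cdot> ?l) \<cdot> ?l" using rl Comp_Ident_left[OF l] by simp
  also have "\<dots> = ?r \<cdot> ?l" using Comp_assoc[OF l l r] ll by simp
  finally show 1: "?l = Ident C A" using rl by simp
  show "?r = Ident C A" using rl Comp_Ident_right[OF r] 1 by simp
qed

locale symmetric_braided_object = symmetric_category +
  fixes V \<sigma>
  assumes braided_object: "braided_object C V \<sigma>"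
begin

abbreviation P :: "nat \<Rightarrow> 'a"
  where "P \<equiv> obj_power C V"

abbreviation Id :: "nat \<Rightarrow> 'b"
  where "Id k \<equiv> Ident C (P k)"

abbreviation E :: "nat \<Rightarrow> 'b set"
  where "E k \<equiv> Hom C (P k) (P k)"

lemma V_Obj [simp]: "V \<in> Obj C"
  using braided_object by (simp add: braided_object_def)

lemma P_Obj [simp]: "P k \<in> Obj C"
  by (induction k) (simp_all add: Unit_closed TensorO_closed)

lemma P_add: "P (j + k) = P j \<odot> P k"
  by (induction j) (simp_all add: TensorO_Unit_left TensorO_assoc)

lemma P_2: "P 2 = V \<odot> V"
  by (simp add: numeral_2_eq_2 TensorO_Unit_right)

lemma arr_power_Ident: "arr_power C (Ident C V) k = Id k"
  by (induction k) (simp_all add: TensorA_Ident)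

lemma E_Arr [simp]: "f \<in> E k \<Longrightarrow> f \<in> Arr C"
  by (simp add: Hom_def)

lemma E_Dom: "f \<in> E k \<Longrightarrow> Dom C f = P k"
  and E_Cod: "f \<in> E k \<Longrightarrow> Cod C f = P k"
  unfolding Hom_def by blast+

lemma Id_E [simp]: "Id k \<in> E k"
  by (simp add: Ident_closed)

lemma Comp_E [simp]: "f \<in> E k \<Longrightarrow> g \<in> E k \<Longrightarrow> g \<cdot> f \<in> E k"
  by (rule Comp_closed)

lemma Comp_Id [simp]: "f \<in> E k \<Longrightarrow> f \<cdot> Id k = f" "f \<in> E k \<Longrightarrow> Id k \<cdot> f = f"
  by (auto intro: Comp_Ident_left Comp_Ident_right)

lemma Comp_assoc_E: "f \<in> E k \<Longrightarrow> g \<in> E k \<Longrightarrow> h \<in> E k \<Longrightarrow> (h \<cdot> g) \<cdot> f = h \<cdot> (g \<cdot> f)"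
  by (rule Comp_assoc)

lemma Tensor_E: "f \<in> E j \<Longrightarrow> g \<in> E k \<Longrightarrow> N = j + k \<Longrightarrow> f \<boxtimes> g \<in> E N"
  using TensorA_closed[of f "P j" "P j" g "P k" "P k"] by (simp add: P_add)

lemma Tensor_Id: "Id j \<boxtimes> Id k = Id (j + k)"
  by (simp add: TensorA_Ident P_add)

lemma interchange_E: "f \<in> E j \<Longrightarrow> g \<in> E j \<Longrightarrow> f' \<in> E k \<Longrightarrow> g' \<in> E k \<Longrightarrow>
    (g \<cdot> f) \<boxtimes> (g' \<cdot> f') = (g \<boxtimes> g') \<cdot> (f \<boxtimes> f')"
  by (rule interchange)

lemma Id_tensor_Comp: "f \<in> E k \<Longrightarrow> g \<in> E k \<Longrightarrow> Id j \<boxtimes> (g \<cdot> f) = (Id j \<boxtimes> g) \<cdot> (Id j \<boxtimes> f)"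
  using interchange_E[of "Id j" j "Id j" f k g] by simp

lemma Comp_tensor_Id: "f \<in> E j \<Longrightarrow> g \<in> E j \<Longrightarrow> (g \<cdot> f) \<boxtimes> Id k = (g \<boxtimes> Id k) \<cdot> (f \<boxtimes> Id k)"
  using interchange_E[of f j g "Id k" k "Id k"] by simp

lemma Tensor_split: "f \<in> E j \<Longrightarrow> g \<in> E k \<Longrightarrow> f \<boxtimes> g = (f \<boxtimes> Id k) \<cdot> (Id j \<boxtimes> g)"
  using interchange_E[of "Id j" j f g k "Id k"] by simp

lemma Tensor_split': "f \<in> E j \<Longrightarrow> g \<in> E k \<Longrightarrow> f \<boxtimes> g = (Id j \<boxtimes> g) \<cdot> (f \<boxtimes> Id k)"
  using interchange_E[of f j "Id j" "Id k" k g] by simp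

lemma sigma_E: "\<sigma> \<in> E 2"
  using braided_object by (simp add: braided_object_def P_2)

lemma inverse_sigma: "inverse_arrows C \<sigma> (inv_arrow C \<sigma>)"
  using braided_object inv_arrow_eq[of \<sigma>] by (auto simp: braided_object_def invertible_arrow_def)

lemma Braid_E: "Braid C V V \<in> E 2"
  using Braid_closed[of V V] by (simp add: P_2)

section \<open>Words as endomorphisms of tensor powers\<close>

primrec gen_index :: "vb_gen \<Rightarrow> nat"
  where
    "gen_index (Sigma_gen i) = i"
  | "gen_index (Zeta_gen i) = i"

text \<open>A formal inverse of a zeta is sent to the braiding itself, which is its own inverse by
  symmetry.\<close>

primrec elementary :: "bool \<Rightarrow> vb_gen \<Rightarrow> 'b"
  where
    "elementary b (Sigma_gen i) = (if b then \<sigma> else inv_arrow C \<sigma>)"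
  | "elementary b (Zeta_gen i) = Braid C V V"

text \<open>Generator \<open>i\<close> acts on strands \<open>i\<close> and \<open>i + 1\<close>,
  which leaves \<open>i - 1\<close> strands before and \<open>n - i - 1\<close> after.\<close>

definition letter :: "nat \<Rightarrow> bool \<times> vb_gen \<Rightarrow> 'b"
  where "letter n l = (case l of (b, x) \<Rightarrow>
    Id (gen_index x - 1) \<boxtimes> elementary b x \<boxtimes> Id (n - gen_index x - 1))"

primrec ev :: "nat \<Rightarrow> vb_gen word \<Rightarrow> 'b"
  where
    "ev n [] = Id n"
  | "ev n (l # w) = letter n l \<cdot> ev n w"

lemma inv_sigma:
  shows inv_sigma_E: "inv_arrow C \<sigma> \<in> E 2"
    and sigma_inv_sigma: "\<sigma> \<cdot> inv_arrow C \<sigma> = Id 2"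
    and inv_sigma_sigma: "inv_arrow C \<sigma> \<cdot> \<sigma> = Id 2"
proof -
  have "Dom C \<sigma> = P 2" "Cod C \<sigma> = P 2"
    using sigma_E unfolding Hom_def by blast+
  then show "inv_arrow C \<sigma> \<in> E 2" "\<sigma> \<cdot> inv_arrow C \<sigma> = Id 2" "inv_arrow C \<sigma> \<cdot> \<sigma> = Id 2"
    using inverse_sigma unfolding inverse_arrows_def by simp_all
qed

lemma elementary_E [simp]: "elementary b x \<in> E 2"
proof (cases x)
  case (Sigma_gen i)
  then show ?thesis using sigma_E inv_sigma_E by (cases b) simp_all
next
  case (Zeta_gen i)
  then show ?thesis using Braid_E by simp
qed

lemma elementary_cancel: "elementary b x \<cdot> elementary (\<not> b) x = Id 2"
proof (cases x)
  case (Sigma_gen i)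
  then show ?thesis using sigma_inv_sigma inv_sigma_sigma by (cases b) simp_all
next
  case (Zeta_gen i)
  then show ?thesis using Braid_symmetric[of V V] by (simp add: P_2)
qed

lemma gen_index_bounds: "x \<in> vb_gens n \<Longrightarrow> 1 \<le> gen_index x \<and> gen_index x < n"
  by (auto simp: vb_gens_def)

lemma gen_index_shift [simp]: "gen_index (shift_gen k x) = k + gen_index x"
  by (cases x) simp_all

lemma elementary_shift [simp]: "elementary b (shift_gen k x) = elementary b x"
  by (cases x) simp_all

lemma letter_E [simp]:
  assumes "x \<in> vb_gens n"
  shows "letter n (b, x) \<in> E n"
proof -
  have "Id (gen_index x - 1) \<boxtimes> elementary b x \<in> E (gen_index x - 1 + 2)"
    by (rule Tensor_E[OF Id_E elementary_E refl])
  then have "letter n (b, x) \<in> E (gen_index x - 1 + 2 + (n - gen_index x - 1))"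
    unfolding letter_def by (simp only: prod.case) (rule Tensor_E[OF _ Id_E refl])
  moreover have "gen_index x - 1 + 2 + (n - gen_index x - 1) = n"
    using gen_index_bounds[OF assms] by simp
  ultimately show ?thesis by simp
qed

lemma letter_shift:
  assumes x: "x \<in> vb_gens n"
  shows "letter (m + n) (b, shift_gen m x) = Id m \<boxtimes> letter n (b, x)"
proof -
  let ?i = "gen_index x"
  have i: "1 \<le> ?i" "?i < n" using gen_index_bounds[OF x] by simp_all
  \<comment> \<open>Truncated subtraction is harmless here, because indices start at 1.\<close>
  have "Id (m + ?i - 1) = Id m \<boxtimes> Id (?i - 1)"
    using i by (simp add: Tensor_Id)
  moreover have "Id m \<in> Arr C" "Id (?i - 1) \<in> Arr C" "elementary b x \<in> Arr C"
      "Id (n - ?i - 1) \<in> Arr C" "Id (?i - 1) \<boxtimes> elementary b x \<in> Arr C"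
    using E_Arr[OF Tensor_E[OF Id_E elementary_E refl]]
    by (simp_all add: E_Arr[OF Id_E] E_Arr[OF elementary_E])
  ultimately have "(Id (m + ?i - 1) \<boxtimes> elementary b x) \<boxtimes> Id (n - ?i - 1) =
      Id m \<boxtimes> ((Id (?i - 1) \<boxtimes> elementary b x) \<boxtimes> Id (n - ?i - 1))"
    using TensorA_assoc[of "Id m" "Id (?i - 1)" "elementary b x"]
      TensorA_assoc[of "Id m" "Id (?i - 1) \<boxtimes> elementary b x" "Id (n - ?i - 1)"] by simp
  then show ?thesis by (simp add: letter_def)
qed

lemma letter_weaken:
  assumes x: "x \<in> vb_gens n"
  shows "letter (n + k) (b, x) = letter n (b, x) \<boxtimes> Id k"
proof -
  let ?i = "gen_index x"
  have i: "1 \<le> ?i" "?i < n" using gen_index_bounds[OF x] by simp_all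
  have "Id (n + k - ?i - 1) = Id (n - ?i - 1) \<boxtimes> Id k"
    using i by (simp add: Tensor_Id)
  moreover have "Id (?i - 1) \<boxtimes> elementary b x \<in> Arr C" "Id (n - ?i - 1) \<in> Arr C" "Id k \<in> Arr C"
    using E_Arr[OF Tensor_E[OF Id_E elementary_E refl]] by (simp_all add: E_Arr[OF Id_E])
  ultimately show ?thesis by (simp add: letter_def TensorA_assoc)
qed

lemma ev_E [simp]: "w \<in> vb_words n \<Longrightarrow> ev n w \<in> E n"
  by (induction w) auto

lemma ev_append: "u \<in> vb_words n \<Longrightarrow> v \<in> vb_words n \<Longrightarrow> ev n (u @ v) = ev n u \<cdot> ev n v"
proof (induction u)
  case (Cons a u)
  then show ?case by (cases a) (simp add: Comp_assoc_E[of _ n])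
qed simp

lemma ev_single: "x \<in> vb_gens n \<Longrightarrow> ev n [(b, x)] = letter n (b, x)"
  by simp

lemma ev_shift: "w \<in> vb_words n \<Longrightarrow> ev (m + n) (shift m w) = Id m \<boxtimes> ev n w"
proof (induction w)
  case Nil
  show ?case by (simp add: Tensor_Id)
next
  case (Cons a w)
  then show ?case by (cases a) (simp add: letter_shift Id_tensor_Comp[of _ n])
qed

lemma ev_weaken: "w \<in> vb_words n \<Longrightarrow> ev (n + k) w = ev n w \<boxtimes> Id k"
proof (induction w)
  case Nil
  show ?case by (simp add: Tensor_Id)
next
  case (Cons a w)
  then show ?case by (cases a) (simp add: letter_weaken Comp_tensor_Id[of _ n])
qed

lemma ev_tensor:
  assumes u: "u \<in> vb_words m" and v: "v \<in> vb_words n"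
  shows "ev (m + n) (u @ shift m v) = ev m u \<boxtimes> ev n v"
  using ev_append[of u "m + n" "shift m v"] Tensor_split[OF ev_E[OF u] ev_E[OF v]]
    words_mono[OF u, of "m + n"] shift_words[OF v, of m "m + n"]
  by (simp add: ev_weaken[OF u] ev_shift[OF v])

text \<open>Both orders evaluate to \<open>ev m u \<boxtimes> ev n v\<close>, by the two ways of
  splitting a tensor product of arrows.\<close>

lemma ev_far:
  assumes u: "u \<in> vb_words m" and v: "v \<in> vb_words n"
  shows "ev (m + n) (u @ shift m v) = ev (m + n) (shift m v @ u)"
  using ev_append[of "shift m v" "m + n" u] Tensor_split'[OF ev_E[OF u] ev_E[OF v]]
    words_mono[OF u, of "m + n"] shift_words[OF v, of m "m + n"]
  by (simp add: ev_weaken[OF u] ev_shift[OF v] ev_tensor[OF u v])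

text \<open>A local relation needs to be checked only on the strands that it touches.\<close>

lemma ev_sandwich:
  assumes "u \<in> vb_words n" and "v \<in> vb_words n" and "ev n u = ev n v" and "N = j + n + k"
  shows "ev N (shift j u) = ev N (shift j v)"
  using ev_weaken[of "shift j u" "j + n" k] ev_weaken[of "shift j v" "j + n" k]
    shift_words[of u n j "j + n"] shift_words[of v n j "j + n"] assms
  by (simp add: ev_shift)

section \<open>The relations of the virtual braid group in the symmetric category\<close>

lemma letter_gens:
  "ev 3 [sig 1] = \<sigma> \<boxtimes> Ident C V" "ev 3 [sig 2] = Ident C V \<boxtimes> \<sigma>"
  "ev 3 [zet 1] = Braid C V V \<boxtimes> Ident C V" "ev 3 [zet 2] = Ident C V \<boxtimes> Braid C V V"
proof -
  have g: "Sigma_gen 1 \<in> vb_gens 3" "Sigma_gen 2 \<in> vb_gens 3" "Zeta_gen 1 \<in> vb_gens 3" "Zeta_gen 2 \<in> vb_gens 3"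
    by (auto simp: vb_gens_def)
  have a: "\<sigma> \<in> Arr C" "Braid C V V \<in> Arr C" "Ident C V \<boxtimes> \<sigma> \<in> Arr C" "Ident C V \<boxtimes> Braid C V V \<in> Arr C"
    using E_Arr[OF sigma_E] E_Arr[OF Braid_E] E_Arr[OF Tensor_E[OF Id_E[of 1] sigma_E refl]]
      E_Arr[OF Tensor_E[OF Id_E[of 1] Braid_E refl]] by (simp_all add: TensorO_Unit_right)
  show "ev 3 [sig 1] = \<sigma> \<boxtimes> Ident C V" "ev 3 [sig 2] = Ident C V \<boxtimes> \<sigma>"
  "ev 3 [zet 1] = Braid C V V \<boxtimes> Ident C V" "ev 3 [zet 2] = Ident C V \<boxtimes> Braid C V V"
    unfolding ev_single[OF g(1)] ev_single[OF g(2)] ev_single[OF g(3)] ev_single[OF g(4)]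
    using a by (simp_all add: letter_def TensorA_Unit_left TensorA_Unit_right TensorO_Unit_right)
qed

text \<open>The first identity is the Yang-Baxter equation of the braided object. The other two are
  a single fact, naturality of the braiding of \<open>V \<odot> V\<close> with \<open>V\<close>
  against an endomorphism \<open>f\<close> of \<open>V \<odot> V\<close>, expanded by a hexagon and
  read for the braiding and for \<open>\<sigma>\<close>.\<close>

lemma ev_braid_relations:
  "ev 3 [sig 1, sig 2, sig 1] = ev 3 [sig 2, sig 1, sig 2]"
  "ev 3 [zet 1, zet 2, zet 1] = ev 3 [zet 2, zet 1, zet 2]"
  "ev 3 [zet 1, zet 2, sig 1] = ev 3 [sig 2, zet 1, zet 2]"
proof -
  have g: "Sigma_gen 1 \<in> vb_gens 3" "Sigma_gen 2 \<in> vb_gens 3" "Zeta_gen 1 \<in> vb_gens 3" "Zeta_gen 2 \<in> vb_gens 3"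
    by (auto simp: vb_gens_def)
  have split: "ev 3 [(a, x), (b, y), (c, z)] = (ev 3 [(a, x)] \<cdot> ev 3 [(b, y)]) \<cdot> ev 3 [(c, z)]"
    if "x \<in> vb_gens 3" "y \<in> vb_gens 3" "z \<in> vb_gens 3" for a b c x y z
    using that by (simp add: Comp_assoc_E[of _ 3])
  let ?c = "Braid C V V" and ?I = "Ident C V"
  show "ev 3 [sig 1, sig 2, sig 1] = ev 3 [sig 2, sig 1, sig 2]"
    unfolding split[OF g(1,2,1)] split[OF g(2,1,2)] letter_gens
    using braided_object by (simp add: braided_object_def)
  have natural: "((?c \<boxtimes> ?I) \<cdot> (?I \<boxtimes> ?c)) \<cdot> (f \<boxtimes> ?I) = (?I \<boxtimes> f) \<cdot> ((?c \<boxtimes> ?I) \<cdot> (?I \<boxtimes> ?c))"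
    if "f \<in> E 2" for f
    using Braid_natural[of f "V \<odot> V" "V \<odot> V" ?I V V] that Ident_closed[of V]
      Braid_tensor_left[of V V V] by (simp add: P_2)
  have assoc: "(ev 3 [(a, x)] \<cdot> ev 3 [(b, y)]) \<cdot> ev 3 [(c, z)] = ev 3 [(a, x)] \<cdot> (ev 3 [(b, y)] \<cdot> ev 3 [(c, z)])"
    if "x \<in> vb_gens 3" "y \<in> vb_gens 3" "z \<in> vb_gens 3" for a b c x y z
    using that by (intro Comp_assoc_E[of _ 3]) simp_all
  show "ev 3 [zet 1, zet 2, zet 1] = ev 3 [zet 2, zet 1, zet 2]"
    unfolding split[OF g(3,4,3)] split[OF g(4,3,4)] assoc[OF g(4,3,4)]
    unfolding letter_gens by (rule natural[OF Braid_E])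
  show "ev 3 [zet 1, zet 2, sig 1] = ev 3 [sig 2, zet 1, zet 2]"
    unfolding split[OF g(3,4,1)] split[OF g(2,3,4)] assoc[OF g(2,3,4)]
    unfolding letter_gens by (rule natural[OF sigma_E])
qed

lemma letter_cancel:
  assumes x: "x \<in> vb_gens n"
  shows "letter n (b, x) \<cdot> letter n (\<not> b, x) = Id n"
proof -
  let ?i = "gen_index x - 1" and ?j = "n - gen_index x - 1"
  have n: "?i + 2 + ?j = n" using gen_index_bounds[OF x] by simp
  have E: "Id ?i \<boxtimes> elementary b x \<in> E (?i + 2)" for b
    by (rule Tensor_E[OF Id_E elementary_E refl])
  have "letter n (b, x) \<cdot> letter n (\<not> b, x) =
      (Id ?i \<boxtimes> (elementary b x \<cdot> elementary (\<not> b) x)) \<boxtimes> Id ?j"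
    unfolding letter_def prod.case Comp_tensor_Id[OF E E, symmetric]
    by (simp add: Id_tensor_Comp[of _ 2])
  also have "\<dots> = Id n" unfolding elementary_cancel Tensor_Id n ..
  finally show ?thesis .
qed

text \<open>\<open>x\<close> and \<open>y\<close> stand for constructors, so that one argument
  covers the three families of commutation relations.\<close>

lemma ev_far_gens:
  assumes ij: "far_apart n i j" and x: "\<And>k N. k \<in> {1..<N} \<Longrightarrow> x k \<in> vb_gens N"
    and y: "\<And>k N. k \<in> {1..<N} \<Longrightarrow> y k \<in> vb_gens N"
    and sx: "\<And>k l. shift_gen k (x l) = x (k + l)" and sy: "\<And>k l. shift_gen k (y l) = y (k + l)"
  shows "ev n [(True, x i), (True, y j)] = ev n [(True, y j), (True, x i)]"
proof -
  consider "i + 1 < j" | "j + 1 < i" using ij by (fastforce simp: far_apart_def)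
  then show ?thesis
  proof cases
    case 1
    \<comment> \<open>Cut the strands after position \<open>j - 1\<close>: generator
      \<open>i\<close> fits to the left of the cut because \<open>i + 1 < j\<close>, and generator
      \<open>j\<close> becomes number 1 on the right.\<close>
    then have n: "n = (j - 1) + (n - (j - 1))" using ij by (auto simp: far_apart_def)
    have "ev ((j - 1) + (n - (j - 1))) ([(True, x i)] @ shift (j - 1) [(True, y 1)]) =
        ev ((j - 1) + (n - (j - 1))) (shift (j - 1) [(True, y 1)] @ [(True, x i)])"
      using 1 ij by (intro ev_far) (auto simp: far_apart_def intro!: x y)
    then show ?thesis using 1 n[symmetric] by (simp add: sy)
  next
    case 2
    then have n: "n = (i - 1) + (n - (i - 1))" using ij by (auto simp: far_apart_def)
    have "ev ((i - 1) + (n - (i - 1))) ([(True, y j)] @ shift (i - 1) [(True, x 1)]) =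
        ev ((i - 1) + (n - (i - 1))) (shift (i - 1) [(True, x 1)] @ [(True, y j)])"
      using 2 ij by (intro ev_far) (auto simp: far_apart_def intro!: x y)
    then show ?thesis using 2 n[symmetric] by (simp add: sx)
  qed
qed

text \<open>The constructors are parameters again, so that each three-strand identity spreads to
  every position.\<close>

lemma ev_adjacent:
  assumes eq: "ev 3 [(True, a 1), (True, b 2), (True, c 1)] = ev 3 [(True, d 2), (True, e 1), (True, f 2)]"
      (is "ev 3 ?u = ev 3 ?v")
    and i: "1 \<le> i" "i + 1 < n"
    and g: "{a, b, c, d, e, f} \<subseteq> {Sigma_gen, Zeta_gen}"
  shows "ev n [(True, a i), (True, b (i + 1)), (True, c i)] =
    ev n [(True, d (i + 1)), (True, e i), (True, f (i + 1))]"
proof -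
  have gens: "x 1 \<in> vb_gens 3 \<and> x 2 \<in> vb_gens 3 \<and> (\<forall>k l. shift_gen k (x l) = x (k + l))"
    if "x \<in> {a, b, c, d, e, f}" for x
  proof -
    have "x = Sigma_gen \<or> x = Zeta_gen" using that g by blast
    then show ?thesis by (auto simp: vb_gens_def)
  qed
  note gens = gens[of a] gens[of b] gens[of c] gens[of d] gens[of e] gens[of f]
  have W: "?u \<in> vb_words 3" "?v \<in> vb_words 3" using gens by simp_all
  have sh: "shift_gen k (a l) = a (k + l)" "shift_gen k (b l) = b (k + l)" "shift_gen k (c l) = c (k + l)"
    "shift_gen k (d l) = d (k + l)" "shift_gen k (e l) = e (k + l)" "shift_gen k (f l) = f (k + l)" for k l
    using gens by simp_all
  have i2: "i - 1 + 2 = i + 1" "i - 1 + 1 = i" using i by auto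
  \<comment> \<open>The three strands involved are \<open>i\<close>, \<open>i + 1\<close> and
    \<open>i + 2\<close>; there remain \<open>i - 1\<close> before and \<open>n - i - 2\<close>
    after them.\<close>
  have "ev n (shift (i - 1) ?u) = ev n (shift (i - 1) ?v)"
    by (rule ev_sandwich[OF W eq, of _ _ "n - i - 2"]) (use i in auto)
  then show ?thesis by (simp only: shift_Cons shift_Nil sh i2)
qed

lemma ev_rel:
  assumes "(l, r) \<in> vb_rels n"
  shows "ev n l = ev n r"
proof -
  have gens: "Sigma_gen k \<in> vb_gens N" "Zeta_gen k \<in> vb_gens N" if "k \<in> {1..<N}" for k N
    using that by (auto simp: vb_gens_def)
  have sh: "shift_gen k (Sigma_gen l) = Sigma_gen (k + l)"
    "shift_gen k (Zeta_gen l) = Zeta_gen (k + l)" for k l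
    by simp_all
  \<comment> \<open>A zeta and its formal inverse have the same value, so this relation is an
    instance of cancellation.\<close>
  have "ev n [zet i, zet i] = ev n []" if "i \<in> {1..<n}" for i
  proof -
    have "letter n (False, Zeta_gen i) = letter n (True, Zeta_gen i)" by (simp add: letter_def)
    then show ?thesis
      using letter_cancel[OF gens(2)[OF that], of True] gens(2)[OF that] by simp
  qed
  with assms show ?thesis
    unfolding vb_rels_def
    using ev_far_gens[of n _ _ Sigma_gen Sigma_gen, OF _ gens(1) gens(1) sh(1) sh(1)]
      ev_far_gens[of n _ _ Zeta_gen Zeta_gen, OF _ gens(2) gens(2) sh(2) sh(2)]
      ev_far_gens[of n _ _ Sigma_gen Zeta_gen, OF _ gens(1) gens(2) sh(1) sh(2)]
      ev_adjacent[of Sigma_gen Sigma_gen Sigma_gen Sigma_gen Sigma_gen Sigma_gen _ n, OF ev_braid_relations(1)]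
      ev_adjacent[of Zeta_gen Zeta_gen Zeta_gen Zeta_gen Zeta_gen Zeta_gen _ n, OF ev_braid_relations(2)]
      ev_adjacent[of Zeta_gen Zeta_gen Sigma_gen Sigma_gen Zeta_gen Zeta_gen _ n, OF ev_braid_relations(3)]
    by (elim UnE CollectE exE conjE) (simp_all del: ev.simps)
qed

text \<open>This makes evaluation well defined on the arrows of \<open>vb_cat\<close> and on the
  elements of \<open>VB n\<close>.\<close>

lemma ev_eq: "vb_eq n u v \<Longrightarrow> ev n u = ev n v"
proof (induction rule: pres_eq.induct)
  case (pres_cancel x u v b)
  then have W: "[(b, x), (\<not> b, x)] \<in> vb_words n" "u \<in> vb_words n" "v \<in> vb_words n"
    by simp_all
  have "ev n [(b, x), (\<not> b, x)] = Id n"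
    using letter_cancel[of x n b] pres_cancel by simp
  then have "ev n ([(b, x), (\<not> b, x)] @ v) = ev n v"
    unfolding ev_append[OF W(1,3)] using W(3) by simp
  moreover have "[(b, x), (\<not> b, x)] @ v \<in> vb_words n"
    using W by (simp only: words_append)
  ultimately show ?case
    using ev_append[OF W(2)] W(3) by presburger
next
  case (pres_rel l r u v)
  then have "l \<in> vb_words n" "r \<in> vb_words n" using vb_rels_words by blast+
  with pres_rel show ?case by (simp add: ev_append ev_rel[of l r n])
qed simp_all

text \<open>One hexagon per crossed strand: the new zeta is the outermost letter and braids
  \<open>V\<close> with the last factor of the power.\<close>

lemma ev_pass_word: "ev (Suc n) (pass_word 0 n) = Braid C V (P n)"
proof (induction n)
  case 0
  show ?case by (simp add: Braid_Unit TensorO_Unit_right)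
next
  case (Suc n)
  let ?c = "Braid C V V"
  have Z: "Zeta_gen (Suc n) \<in> vb_gens (Suc (Suc n))" by (simp add: vb_gens_def)
  have W: "pass_word 0 n \<in> vb_words (Suc n)" by (rule pass_word_words) simp
  have arr: "Id n \<boxtimes> ?c \<in> Arr C"
    using E_Arr[OF Tensor_E[OF Id_E[of n] Braid_E refl]] .
  \<comment> \<open>\<open>obj_power\<close> adds its factor on the left, while the crossing word
    grows on the right.\<close>
  have PS: "P (Suc n) = P n \<odot> V" using P_add[of n 1] by (simp add: TensorO_Unit_right)
  have "ev (Suc (Suc n)) (pass_word 0 (Suc n)) = letter (Suc (Suc n)) (zet (Suc n)) \<cdot> ev (Suc n + 1) (pass_word 0 n)"
    using pass_word_add[of 0 n 1] by simp
  also have "\<dots> = (Id n \<boxtimes> ?c) \<cdot> (Braid C V (P n) \<boxtimes> Ident C V)"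
    unfolding ev_weaken[OF W] Suc.IH using arr
    by (simp add: letter_def TensorA_Unit_right TensorO_Unit_right)
  also have "\<dots> = Braid C V (P n \<odot> V)" by (simp add: Braid_tensor_right)
  finally show ?case unfolding PS .
qed

text \<open>The other hexagon, applied to the first of the \<open>m\<close> strands. This is what
  makes evaluation preserve the braidings of all objects.\<close>

lemma ev_braid_word: "ev (m + n) (braid_word m n) = Braid C (P m) (P n)"
proof (induction m)
  case 0
  show ?case by (simp add: Braid_Unit)
next
  case (Suc m)
  have W: "pass_word 0 n \<in> vb_words (Suc n)" "braid_word m n \<in> vb_words (m + n)"
    by (simp_all add: pass_word_words braid_word_words)
  have W': "pass_word 0 n \<in> vb_words (Suc m + n)" "shift 1 (braid_word m n) \<in> vb_words (Suc m + n)"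
    using W by (auto intro: shift_words pass_word_words)
  have "ev (Suc m + n) (braid_word (Suc m) n) =
      ev (Suc n + m) (pass_word 0 n) \<cdot> ev (1 + (m + n)) (shift 1 (braid_word m n))"
    using braid_word_add_left[of 1 m n] ev_append[OF W'] by (simp add: add.commute)
  also have "\<dots> = (Braid C V (P n) \<boxtimes> Id m) \<cdot> (Ident C V \<boxtimes> Braid C (P m) (P n))"
    unfolding ev_weaken[OF W(1)] ev_shift[OF W(2)] ev_pass_word Suc.IH
    by (simp add: TensorO_Unit_right)
  also have "\<dots> = Braid C (P (Suc m)) (P n)" by (simp add: Braid_tensor_left)
  finally show ?case .
qed

end


section \<open>Symmetric functors\<close>

lemma (in category) Comp_Arr: "f \<in> Arr C \<Longrightarrow> g \<in> Arr C \<Longrightarrow> Dom C g = Cod C f \<Longrightarrow>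
    g \<cdot> f \<in> Arr C \<and> Dom C (g \<cdot> f) = Dom C f \<and> Cod C (g \<cdot> f) = Cod C g"
  using Comp_closed[of f "Dom C f" "Cod C f" g "Cod C g"] by (simp add: Hom_def)

lemma (in category) Ident_Arr: "A \<in> Obj C \<Longrightarrow> Ident C A \<in> Arr C"
  using Ident_closed by (simp add: Hom_def)

lemma (in strict_monoidal_category) TensorA_Arr: "f \<in> Arr C \<Longrightarrow> g \<in> Arr C \<Longrightarrow> f \<boxtimes> g \<in> Arr C"
  using TensorA_closed[of f "Dom C f" "Cod C f" g "Dom C g" "Cod C g"] by (simp add: Hom_def)

lemma (in braided_category) Braid_Arr: "A \<in> Obj C \<Longrightarrow> B \<in> Obj C \<Longrightarrow> Braid C A B \<in> Arr C"
  using Braid_closed by (simp add: Hom_def)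

context
  fixes C :: "('o, 'm, 'x) braided_monoidal_scheme"
    and D :: "('p, 'q, 'y) braided_monoidal_scheme"
    and F :: "('o \<Rightarrow> 'p) \<times> ('m \<Rightarrow> 'q)"
  assumes F: "symmetric_functor C D F"
begin

lemma functor_Obj: "A \<in> Obj C \<Longrightarrow> fst F A \<in> Obj D"
  and functor_Arr: "f \<in> Arr C \<Longrightarrow> snd F f \<in> Arr D"
  and functor_Dom: "f \<in> Arr C \<Longrightarrow> Dom D (snd F f) = fst F (Dom C f)"
  and functor_Cod: "f \<in> Arr C \<Longrightarrow> Cod D (snd F f) = fst F (Cod C f)"
  and functor_Ident: "A \<in> Obj C \<Longrightarrow> snd F (Ident C A) = Ident D (fst F A)"
  and functor_Comp: "f \<in> Arr C \<Longrightarrow> g \<in> Arr C \<Longrightarrow> Dom C g = Cod C f \<Longrightarrow>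
    snd F (g \<cdot>\<^bsub>C\<^esub> f) = snd F g \<cdot>\<^bsub>D\<^esub> snd F f"
  and functor_Unit: "fst F (Unit C) = Unit D"
  and functor_TensorO: "A \<in> Obj C \<Longrightarrow> B \<in> Obj C \<Longrightarrow> fst F (A \<odot>\<^bsub>C\<^esub> B) = fst F A \<odot>\<^bsub>D\<^esub> fst F B"
  and functor_TensorA: "f \<in> Arr C \<Longrightarrow> g \<in> Arr C \<Longrightarrow>
    snd F (f \<boxtimes>\<^bsub>C\<^esub> g) = snd F f \<boxtimes>\<^bsub>D\<^esub> snd F g"
  and functor_Braid: "A \<in> Obj C \<Longrightarrow> B \<in> Obj C \<Longrightarrow>
    snd F (Braid C A B) = Braid D (fst F A) (fst F B)"
  using F by (auto simp: symmetric_functor_def split: prod.splits)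

lemma functor_Hom: "f \<in> Hom C A B \<Longrightarrow> snd F f \<in> Hom D (fst F A) (fst F B)"
  by (auto simp: Hom_def functor_Arr functor_Dom functor_Cod)

lemma functor_inverse_arrows:
  assumes C: "category C" and inv: "inverse_arrows C f g"
  shows "inverse_arrows D (snd F f) (snd F g)"
proof -
  have "f \<in> Arr C" "g \<in> Hom C (Cod C f) (Dom C f)"
    using inv by (simp_all add: inverse_arrows_def)
  then show ?thesis
    using functor_Comp[of f g] functor_Comp[of g f] functor_Hom[of g "Cod C f" "Dom C f"] inv
      category.Dom_closed[OF C] category.Cod_closed[OF C]
    by (simp add: inverse_arrows_def Hom_def functor_Arr functor_Dom functor_Cod functor_Ident)
qed

end

lemma symmetric_functor_compose:
  assumes C: "symmetric_category C"
    and F: "symmetric_functor C D F" and G: "symmetric_functor D B G"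
  shows "symmetric_functor C B (compose (Obj C) (fst G) (fst F), compose (Arr C) (snd G) (snd F))"
proof -
  interpret symmetric_category C by (rule C)
  note f = functor_Obj[OF F] functor_Arr[OF F] functor_Dom[OF F] functor_Cod[OF F]
    functor_Ident[OF F] functor_Comp[OF F] functor_Unit[OF F] functor_TensorO[OF F]
    functor_TensorA[OF F] functor_Braid[OF F]
  note g = functor_Obj[OF G] functor_Arr[OF G] functor_Dom[OF G] functor_Cod[OF G]
    functor_Ident[OF G] functor_Comp[OF G] functor_Unit[OF G] functor_TensorO[OF G]
    functor_TensorA[OF G] functor_Braid[OF G]
  show ?thesis
    unfolding symmetric_functor_def prod.case
    by (intro conjI ballI impI)
      (auto simp: compose_def f g Dom_closed Cod_closed Ident_Arr Comp_Arr Unit_closed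
        TensorO_closed TensorA_Arr Braid_Arr)
qed

lemma symmetric_functor_identity:
  assumes "symmetric_category C"
  shows "symmetric_functor C C (\<lambda>A\<in>Obj C. A, \<lambda>f\<in>Arr C. f)"
proof -
  interpret symmetric_category C by (rule assms)
  show ?thesis
    unfolding symmetric_functor_def prod.case
    by (auto simp: Dom_closed Cod_closed Ident_Arr Comp_Arr Unit_closed
        TensorO_closed TensorA_Arr Braid_Arr)
qed


section \<open>Evaluation as a symmetric functor\<close>

context symmetric_braided_object
begin

text \<open>Only the arrow map has to be restricted: every natural number is an object of
  \<open>vb_cat\<close>, but not every one codes an arrow.\<close>

definition ev_functor :: "(nat \<Rightarrow> 'a) \<times> (nat \<Rightarrow> 'b)"
  where "ev_functor = (P, \<lambda>f\<in>Arr vb_cat. ev (vb_degree f) (vb_word f))"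

lemma fst_ev_functor [simp]: "fst ev_functor = P"
  by (simp add: ev_functor_def)

lemma snd_ev_functor: "w \<in> vb_words n \<Longrightarrow> snd ev_functor (vb_arr n w) = ev n w"
  using ev_eq[OF vb_word_arr[of w n]] by (auto simp: ev_functor_def Arr_vb_cat)

lemma symmetric_functor_ev_functor: "symmetric_functor vb_cat C ev_functor"
proof -
  have hom: "snd ev_functor f \<in> E (vb_degree f)" if "f \<in> Arr vb_cat" for f
    using that by (auto simp: Arr_vb_cat snd_ev_functor)
  have dom: "Dom C (snd ev_functor f) = P (vb_degree f)" "Cod C (snd ev_functor f) = P (vb_degree f)"
    if "f \<in> Arr vb_cat" for f
    using hom[OF that] by (rule E_Dom, rule E_Cod)
  have ext: "snd ev_functor \<in> extensional (Arr vb_cat)"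
    by (simp add: ev_functor_def)
  have comp: "snd ev_functor (g \<cdot>\<^bsub>vb_cat\<^esub> f) = snd ev_functor g \<cdot> snd ev_functor f"
    if "f \<in> Arr vb_cat" "g \<in> Arr vb_cat" "vb_degree g = vb_degree f" for f g
    using that by (auto simp: Arr_vb_cat snd_ev_functor ev_append)
  have tensor: "snd ev_functor (f \<boxtimes>\<^bsub>vb_cat\<^esub> g) = snd ev_functor f \<boxtimes> snd ev_functor g"
    if "f \<in> Arr vb_cat" "g \<in> Arr vb_cat" for f g
    using that by (auto simp: Arr_vb_cat snd_ev_functor ev_tensor simp del: words_append)
  have "symmetric_functor vb_cat C (fst ev_functor, snd ev_functor)"
    unfolding symmetric_functor_def prod.case
    using ext E_Arr[OF hom]
    by (auto simp: PiE_def dom comp tensor P_add snd_ev_functor braid_word_words ev_braid_word)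
  then show ?thesis unfolding prod.collapse .
qed

lemma ev_functor_V: "fst ev_functor 1 = V"
  by (simp add: TensorO_Unit_right)

lemma ev_functor_sigma: "snd ev_functor (vb_arr 2 [sig 1]) = \<sigma>"
proof -
  have g: "Sigma_gen 1 \<in> vb_gens 2" by (auto simp: vb_gens_def)
  then have "snd ev_functor (vb_arr 2 [sig 1]) = letter 2 (sig 1)"
    by (simp add: snd_ev_functor)
  then show ?thesis
    using E_Arr[OF sigma_E] by (simp add: letter_def TensorA_Unit_left TensorA_Unit_right)
qed

section \<open>Recovering a virtual braid from its value\<close>

context
  fixes F
  assumes F: "symmetric_functor C vb_cat F"
    and FV: "fst F V = 1" and Fs: "snd F \<sigma> = vb_arr 2 [sig 1]"
begin

lemma functor_P: "fst F (P k) = k"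
  by (induction k) (simp_all add: functor_Unit[OF F] functor_TensorO[OF F] FV)

lemma functor_elementary:
  assumes x: "x = Sigma_gen 1 \<or> x = Zeta_gen 1"
  shows "snd F (elementary b x) = vb_arr 2 [(b, x)]"
proof -
  interpret vb: symmetric_category vb_cat by (rule symmetric_category_vb_cat)
  have "inverse_arrows vb_cat (snd F \<sigma>) (snd F (inv_arrow C \<sigma>))"
    by (rule functor_inverse_arrows[OF F category_axioms inverse_sigma])
  then have "snd F (inv_arrow C \<sigma>) = vb_arr 2 [(False, Sigma_gen 1)]"
    unfolding Fs using vb.inv_arrow_eq inverse_sigma_vb_cat by metis
  moreover have "snd F (Braid C V V) = vb_arr 2 [zet 1]"
    using functor_Braid[OF F V_Obj V_Obj] by (simp add: FV numeral_2_eq_2)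
  \<comment> \<open>For \<open>b = False\<close> the elementary arrow of a zeta is still the
    braiding, so a zeta has to agree with its formal inverse in \<open>VB 2\<close>.\<close>
  moreover have "vb_arr 2 [zet 1] = vb_arr 2 [(False, Zeta_gen 1)]"
  proof (rule vb_arr_eq)
    have g: "Zeta_gen 1 \<in> vb_gens 2" by (auto simp: vb_gens_def)
    have "vb_eq 2 ([] @ [zet 1]) ([(False, Zeta_gen 1), (\<not> False, Zeta_gen 1)] @ [zet 1])"
      using pres_cancel[of "Zeta_gen 1" "vb_gens 2" "[]" "[zet 1]" "vb_rels 2" False] g
      by (simp add: pres_sym)
    also have "[(False, Zeta_gen 1), (\<not> False, Zeta_gen 1)] @ [zet 1] =
        [(False, Zeta_gen 1)] @ [zet 1, zet 1] @ []"
      by simp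
    also have "vb_eq 2 \<dots> ([(False, Zeta_gen 1)] @ [])"
      by (rule zeta_cancel) (use g in auto)
    finally show "vb_eq 2 [zet 1] [(False, Zeta_gen 1)]" by simp
  qed
  ultimately show ?thesis using x Fs by (cases b) auto
qed

lemma functor_letter:
  assumes x: "x \<in> vb_gens n"
  shows "snd F (letter n (b, x)) = vb_arr n [(b, x)]"
proof -
  define i where "i = gen_index x - 1"
  define j where "j = n - gen_index x - 1"
  have n: "n = i + 2 + j" using gen_index_bounds[OF x] by (simp add: i_def j_def)
  \<comment> \<open>Every generator is generator 1 on two strands with \<open>i\<close> strands put
    before it and \<open>j\<close> after it.\<close>
  obtain y where y: "y = Sigma_gen 1 \<or> y = Zeta_gen 1" "x = shift_gen i y"
    using x that[of "Sigma_gen 1"] that[of "Zeta_gen 1"] by (auto simp: vb_gens_def i_def)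
  have W: "[(b, y)] \<in> vb_words 2" using y(1) by (auto simp: vb_gens_def)
  then have W': "[(b, x)] \<in> vb_words (i + 2)" using shift_words[OF W, of i "i + 2"] y by simp
  have "letter n (b, x) = Id i \<boxtimes> elementary b y \<boxtimes> Id j"
    by (simp only: letter_def prod.case i_def[symmetric] j_def[symmetric])
      (simp add: y(2))
  moreover have "Id i \<boxtimes> elementary b y \<in> Arr C"
    using E_Arr[OF Tensor_E[OF Id_E elementary_E refl]] .
  ultimately have "snd F (letter n (b, x)) =
      (vb_arr i [] \<boxtimes>\<^bsub>vb_cat\<^esub> vb_arr 2 [(b, y)]) \<boxtimes>\<^bsub>vb_cat\<^esub> vb_arr j []"
    by (simp add: functor_TensorA[OF F] functor_Ident[OF F] functor_P functor_elementary[OF y(1)]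
      E_Arr[OF Id_E] E_Arr[OF elementary_E])
  also have "\<dots> = vb_arr n [(b, x)]"
    using W W' unfolding n y(2) by (simp del: words_Cons)
  finally show ?thesis .
qed

text \<open>The functor is a left inverse of evaluation on classes; the injectivity of evaluation
  rests on this.\<close>

lemma functor_ev: "w \<in> vb_words n \<Longrightarrow> snd F (ev n w) = vb_arr n w"
proof (induction w)
  case Nil
  show ?case by (simp add: functor_Ident[OF F] functor_P)
next
  case (Cons a w)
  obtain b x where a: "a = (b, x)" by (cases a)
  with Cons.prems have x: "x \<in> vb_gens n" and w: "w \<in> vb_words n" by simp_all
  have "ev n w \<in> E n" "letter n (b, x) \<in> E n" using x w by simp_all
  then have "snd F (letter n (b, x) \<cdot> ev n w) = snd F (letter n (b, x)) \<cdot>\<^bsub>vb_cat\<^esub> snd F (ev n w)"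
    by (intro functor_Comp[OF F]) (simp_all add: E_Dom E_Cod)
  then show ?case using x w by (simp add: a functor_letter[OF x] Cons.IH[OF w])
qed

end

end


section \<open>Bijectivity of evaluation on the endomorphisms of a tensor power\<close>

theorem theorem4:
  fixes C :: "('o, 'm) braided_monoidal" (structure)
    and V :: 'o and \<sigma> :: 'm and n :: nat
  assumes "free_symmetric_category C V \<sigma>"
  shows "group (End_monoid C (obj_power C V n)) \<and>
    (\<exists>\<psi> \<in> iso (VB n) (End_monoid C (obj_power C V n)). \<forall>i \<in> {1..<n}.
      \<psi> (vb_zeta n i) =
        arr_power C (Ident C V) (i - 1) \<boxtimes> Braid C V V \<boxtimes> arr_power C (Ident C V) (n - i - 1) \<and>
      \<psi> (vb_sigma n i) =
        arr_power C (Ident C V) (i - 1) \<boxtimes> \<sigma> \<boxtimes> arr_power C (Ident C V) (n - i - 1) \<and>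
      \<psi> (inv\<^bsub>VB n\<^esub> (vb_sigma n i)) =
        arr_power C (Ident C V) (i - 1) \<boxtimes> inv_arrow C \<sigma> \<boxtimes> arr_power C (Ident C V) (n - i - 1))"
proof -
  have sym: "symmetric_category C" and obj: "braided_object C V \<sigma>"
    and univ: "universal_among TYPE('o \<times> 'm) C V \<sigma>" "universal_among TYPE(nat \<times> nat) C V \<sigma>"
    using assms by (simp_all add: free_symmetric_category_def)
  interpret symmetric_braided_object C V \<sigma>
    using sym obj by (simp add: symmetric_braided_object_def symmetric_braided_object_axioms_def)
  obtain F where F: "symmetric_functor C vb_cat F" and FV: "fst F V = 1"
    and Fs: "snd F \<sigma> = vb_arr 2 [sig 1]"
    using univ(2) symmetric_category_vb_cat braided_object_vb_cat unfolding universal_among_def by blast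
  let ?H = "(compose (Obj C) (fst ev_functor) (fst F), compose (Arr C) (snd ev_functor) (snd F))"
  have s: "\<sigma> \<in> Arr C" using E_Arr[OF sigma_E] .
  have "\<exists>!F. symmetric_functor C C F \<and> fst F V = V \<and> snd F \<sigma> = \<sigma>"
    using univ(1) sym obj unfolding universal_among_def by blast
  moreover have "symmetric_functor C C ?H \<and> fst ?H V = V \<and> snd ?H \<sigma> = \<sigma>"
    using symmetric_functor_compose[OF sym F symmetric_functor_ev_functor] ev_functor_V ev_functor_sigma
      s by (simp add: compose_eq FV Fs)
  moreover have "symmetric_functor C C (\<lambda>A\<in>Obj C. A, \<lambda>f\<in>Arr C. f) \<and>
      fst (\<lambda>A\<in>Obj C. A, \<lambda>f\<in>Arr C. f) V = V \<and> snd (\<lambda>A\<in>Obj C. A, \<lambda>f\<in>Arr C. f) \<sigma> = \<sigma>"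
    using symmetric_functor_identity[OF sym] s by simp
  ultimately have H: "?H = (\<lambda>A\<in>Obj C. A, \<lambda>f\<in>Arr C. f)" by blast
  have retract: "snd ev_functor (snd F f) = f" if "f \<in> Arr C" for f
    using arg_cong[OF H, of "\<lambda>G. snd G f"] that by (simp add: compose_eq)

  interpret VB: group "VB n" by (rule group_VB)
  let ?cl = "pres_class (vb_gens n) (vb_rels n)"
  have carrier: "carrier (VB n) = ?cl ` vb_words n" and one: "\<one>\<^bsub>VB n\<^esub> = ?cl []"
    by (simp_all add: VB_def presented_group_def)
  have mult: "?cl u \<otimes>\<^bsub>VB n\<^esub> ?cl v = ?cl (u @ v)" if "u \<in> vb_words n" "v \<in> vb_words n" for u v
    unfolding VB_def using that by (rule pres_mult[OF vb_rels_words])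
  \<comment> \<open>Any representative of the class may be evaluated, since equivalent words have
    the same value.\<close>
  define \<psi> where "\<psi> a = ev n (SOME w. w \<in> a)" for a
  have \<psi>: "\<psi> (?cl w) = ev n w" if "w \<in> vb_words n" for w
  proof -
    have "vb_eq n w (SOME v. v \<in> ?cl w)"
      using pres_refl[OF that, of "vb_rels n"] unfolding pres_class_def mem_Collect_eq by (rule someI)
    then show ?thesis by (simp add: \<psi>_def ev_eq)
  qed
  have hom: "\<psi> \<in> hom (VB n) (End_monoid C (P n))"
    by (rule homI) (auto simp: carrier mult \<psi> ev_append End_monoid_def)
  have inj: "inj_on \<psi> (carrier (VB n))"
  proof (rule inj_onI)
    fix a b assume "a \<in> carrier (VB n)" "b \<in> carrier (VB n)" "\<psi> a = \<psi> b"
    then obtain u v where uv: "u \<in> vb_words n" "v \<in> vb_words n" "a = ?cl u" "b = ?cl v"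
      "ev n u = ev n v"
      by (auto simp: carrier \<psi>)
    \<comment> \<open>Apply \<open>F\<close> to the common value of the two words.\<close>
    then have "vb_arr n u = vb_arr n v"
      using functor_ev[OF F FV Fs] by metis
    then show "a = b" using uv by (simp add: pres_class_eqI vb_arr_eqD)
  qed
  have "f \<in> \<psi> ` carrier (VB n)" if f: "f \<in> E n" for f
  proof -
    \<comment> \<open>\<open>F\<close> sends the tensor power to the number \<open>n\<close>, so the
      image of \<open>f\<close> is a word on \<open>n\<close> strands; evaluating that word gives
      back \<open>f\<close> by \<open>retract\<close>.\<close>
    have "snd F f \<in> Hom vb_cat n n"
      using functor_Hom[OF F f] by (simp add: functor_P[OF F FV Fs])
    then obtain w where w: "w \<in> vb_words n" "snd F f = vb_arr n w" by (auto simp: Hom_vb_cat)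
    then have "f = \<psi> (?cl w)"
      using retract[OF E_Arr[OF f]] by (simp add: snd_ev_functor \<psi>)
    then show ?thesis using w by (auto simp: carrier)
  qed
  then have bij: "bij_betw \<psi> (carrier (VB n)) (carrier (End_monoid C (P n)))"
    using inj hom by (auto simp: bij_betw_def hom_def End_monoid_def)
  with hom have iso: "\<psi> \<in> iso (VB n) (End_monoid C (P n))" by (simp add: iso_def)
  \<comment> \<open>The group structure is transported along \<open>\<psi>\<close>. The transported
    unit is the image of the unit of \<open>VB n\<close>, and it has to be recognised as the unit of
    \<open>End_monoid\<close>.\<close>
  have "\<psi> \<one>\<^bsub>VB n\<^esub> = \<one>\<^bsub>End_monoid C (P n)\<^esub>" by (simp add: one \<psi> End_monoid_def)
  with VB.iso_imp_img_group[OF iso] have "group (End_monoid C (P n))" by simp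
  moreover have "\<psi> (vb_zeta n i) =
        arr_power C (Ident C V) (i - 1) \<boxtimes> Braid C V V \<boxtimes> arr_power C (Ident C V) (n - i - 1) \<and>
      \<psi> (vb_sigma n i) =
        arr_power C (Ident C V) (i - 1) \<boxtimes> \<sigma> \<boxtimes> arr_power C (Ident C V) (n - i - 1) \<and>
      \<psi> (inv\<^bsub>VB n\<^esub> (vb_sigma n i)) =
        arr_power C (Ident C V) (i - 1) \<boxtimes> inv_arrow C \<sigma> \<boxtimes> arr_power C (Ident C V) (n - i - 1)"
    if i: "i \<in> {1..<n}" for i
  proof -
    have g: "Sigma_gen i \<in> vb_gens n" "Zeta_gen i \<in> vb_gens n" using i by (auto simp: vb_gens_def)
    \<comment> \<open>The inverse of the class of a sigma is the class of its formal inverse letter,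
      which evaluates to \<open>inv_arrow C \<sigma>\<close> between identities.\<close>
    have "?cl [(False, Sigma_gen i), sig i] = ?cl []"
      using pres_cancel[of "Sigma_gen i" "vb_gens n" "[]" "[]" "vb_rels n" False] g
      by (intro pres_class_eqI) simp
    then have "inv\<^bsub>VB n\<^esub> (?cl [sig i]) = ?cl [(False, Sigma_gen i)]"
      using g by (intro VB.inv_equality) (auto simp: mult carrier one)
    moreover have "\<psi> (?cl [(b, x)]) = letter n (b, x)" if "x \<in> vb_gens n" for b x
      using that by (simp add: \<psi>)
    ultimately show ?thesis
      unfolding vb_zeta_def vb_sigma_def arr_power_Ident
      using g by (simp add: letter_def)
  qed
  ultimately show ?thesis using iso by blast
qed

end
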